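(* Let $\mathcal{A}$ be a unital $C^*$-algebra, let $\mathcal{F}\subseteq\mathcal{A}$ be an ideal of finite type elements, and let $a\in\mathcal{A}$. Then the following statements hold. 1) If $a$ belongs to the boundary of $\mathcal{K}\Phi(\mathcal{A})$ in $\mathcal{A}$, then $a\in\mathcal{A}\setminus(\mathcal{K}\Phi_{+}(\mathcal{A})\cup\mathcal{K}\Phi_{-}(\mathcal{A}))$. 2) If $a$ belongs to the boundary of $\mathcal{K}\Phi_{+}^{-}(\mathcal{A})$ in $\mathcal{A}$, then $a\in\mathcal{A}\setminus\mathcal{K}\Phi_{+}(\mathcal{A})$. 3) If $a$ belongs to the boundary of $\mathcal{K}\Phi_{-}^{+}(\mathcal{A})$ in $\mathcal{A}$, then $a\in\mathcal{A}\setminus\mathcal{K}\Phi_{-}(\mathcal{A})$. 4) If $a$ belongs to the boundary of $\mathcal{K}\Phi_{0}(\mathcal{A})$ in $\mathcal{A}$, then $a\in\mathcal{A}\setminus\mathcal{K}\Phi(\mathcal{A})$.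
   Context: Boundaries are with respect to the norm topology of $\mathcal{A}$. Ideal of finite type elements: a subalgebra $\mathcal{F}\subseteq\mathcal{A}$ such that (i) $\mathcal{F}$ is a selfadjoint ideal: $ab,ba\in\mathcal{F}$ for all $a\in\mathcal{A}$, $b\in\mathcal{F}$, and $a\in\mathcal{F}$ implies $a^*\in\mathcal{F}$; (ii) there is an approximate unit $(p_\alpha)$ (in the norm topology) for $\mathcal{F}$ consisting of projections; (iii) if $p,q\in\mathcal{F}$ are projections, then there exists $v\in\mathcal{A}$ such that $vv^*=q$ and $v^*v\perp p$, i.e. $v^*v+p$ is a projection. For projections $p,q\in\mathcal{A}$: $p\sim q$ means there is $v\in\mathcal{A}$ with $vv^*=p$, $v^*v=q$; $p\preceq q$ means there is a projection $p'\in\mathcal{A}$ with $p'\le q$ and $p\sim p'$. For $a\in\mathcal{A}$ and projections $p,q\in\mathcal{A}$, $a$ is invertible up to the pair $(p,q)$ if, with $a'=(1-q)a(1-p)$, there is $b\in\mathcal{A}$ with $b=(1-p)b(1-q)$, $a'b=1-q$, $ba'=1-p$. With respect to the fixed ideal $\mathcal{F}$: $\mathcal{K}\Phi_{+}(\mathcal{A})$ (upper semi-Fredholm type), resp. $\mathcal{K}\Phi_{-}(\mathcal{A})$ (lower semi-Fredholm type), resp. $\mathcal{K}\Phi(\mathcal{A})$ (Fredholm type), is the set of $a\in\mathcal{A}$ that are invertible up to some pair $(p,q)$ of projections in $\mathcal{A}$ with $p\in\mathcal{F}$, resp. $q\in\mathcal{F}$, resp. $p,q\in\mathcal{F}$.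 $\mathcal{K}\Phi_{+}^{-}(\mathcal{A})$ (upper semi-Weyl type), resp. $\mathcal{K}\Phi_{-}^{+}(\mathcal{A})$ (lower semi-Weyl type), resp. $\mathcal{K}\Phi_{0}(\mathcal{A})$ (Weyl type), is the set of $a\in\mathcal{A}$ that are invertible up to some pair $(p,q)$ of projections in $\mathcal{A}$ with $p\in\mathcal{F}$ and $p\preceq q$, resp. $q\in\mathcal{F}$ and $q\preceq p$, resp. $p,q\in\mathcal{F}$ and $p\sim q$. *)

theory Defs
  imports "HOL-Analysis.Analysis"
begin

text \<open>
  Unital complex C*-algebras. The class \<open>real_normed_algebra_1\<close> is deliberately not used: it
  would force \<open>1 \<noteq> 0\<close>, whereas here the zero algebra is admitted. (If \<open>1 \<noteq> 0\<close>, then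
  \<open>norm 1 = 1\<close> follows from the C*-identity.)
\<close>

class unital_cstar_algebra = real_normed_algebra + banach + monoid_mult +
  fixes scaleC :: "complex \<Rightarrow> 'a \<Rightarrow> 'a"
    and star :: "'a \<Rightarrow> 'a"
  assumes scaleC_add_right: "scaleC c (x + y) = scaleC c x + scaleC c y"
    and scaleC_add_left: "scaleC (c + d) x = scaleC c x + scaleC d x"
    and scaleC_scaleC: "scaleC c (scaleC d x) = scaleC (c * d) x"
    and scaleC_of_real: "scaleC (complex_of_real r) x = scaleR r x"
    and mult_scaleC_left: "scaleC c x * y = scaleC c (x * y)"
    and mult_scaleC_right: "x * scaleC c y = scaleC c (x * y)"
    and norm_scaleC: "norm (scaleC c x) = cmod c * norm x"
    and star_star: "star (star x) = x"
    and star_add: "star (x + y) = star x + star y"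
    and star_scaleC: "star (scaleC c x) = scaleC (cnj c) (star x)"
    and star_mult: "star (x * y) = star y * star x"
    and cstar_identity: "norm (star x * x) = (norm x)\<^sup>2"

definition is_proj :: "'a::unital_cstar_algebra \<Rightarrow> bool" where
  "is_proj p \<longleftrightarrow> p * p = p \<and> star p = p"

text \<open>The usual order only when both arguments are projections.\<close>

definition proj_le :: "'a::unital_cstar_algebra \<Rightarrow> 'a \<Rightarrow> bool" where
  "proj_le p q \<longleftrightarrow> p * q = p \<and> q * p = p"

definition proj_equiv :: "'a::unital_cstar_algebra \<Rightarrow> 'a \<Rightarrow> bool" where
  "proj_equiv p q \<longleftrightarrow> (\<exists>v. v * star v = p \<and> star v * v = q)"

definition proj_subequiv :: "'a::unital_cstar_algebra \<Rightarrow> 'a \<Rightarrow> bool" where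
  "proj_subequiv p q \<longleftrightarrow> (\<exists>p'. is_proj p' \<and> proj_le p' q \<and> proj_equiv p p')"

definition subalgebra :: "'a::unital_cstar_algebra set \<Rightarrow> bool" where
  "subalgebra F \<longleftrightarrow> 0 \<in> F \<and> (\<forall>x\<in>F. \<forall>y\<in>F. x + y \<in> F \<and> x * y \<in> F) \<and>
     (\<forall>c. \<forall>x\<in>F. scaleC c x \<in> F)"

definition selfadjoint_ideal :: "'a::unital_cstar_algebra set \<Rightarrow> bool" where
  "selfadjoint_ideal F \<longleftrightarrow> (\<forall>a. \<forall>b\<in>F. a * b \<in> F \<and> b * a \<in> F) \<and> (\<forall>a\<in>F. star a \<in> F)"

definition directed_index :: "'i set \<Rightarrow> ('i \<Rightarrow> 'i \<Rightarrow> bool) \<Rightarrow> bool" where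
  "directed_index I le \<longleftrightarrow> I \<noteq> {} \<and> (\<forall>i\<in>I. le i i) \<and>
     (\<forall>i\<in>I. \<forall>j\<in>I. \<forall>k\<in>I. le i j \<longrightarrow> le j k \<longrightarrow> le i k) \<and>
     (\<forall>i\<in>I. \<forall>j\<in>I. \<exists>k\<in>I. le i k \<and> le j k)"

text \<open>The net is not required to be increasing.\<close>

definition approx_unit_of_projs ::
    "'a::unital_cstar_algebra set \<Rightarrow> 'i set \<Rightarrow> ('i \<Rightarrow> 'i \<Rightarrow> bool) \<Rightarrow> ('i \<Rightarrow> 'a) \<Rightarrow> bool" where
  "approx_unit_of_projs F I le p \<longleftrightarrow> directed_index I le \<and> (\<forall>i\<in>I. p i \<in> F \<and> is_proj (p i)) \<and>
     (\<forall>x\<in>F. \<forall>e>0. \<exists>i\<in>I. \<forall>j\<in>I. le i j \<longrightarrow> norm (p j * x - x) < e \<and> norm (x * p j - x) < e)"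

text \<open>
  HOL cannot quantify existentially over the index type of a net, so that type is an argument;
  theorems assuming \<open>finite_type_ideal TYPE('i) F\<close> for a type variable \<open>'i\<close> cover all nets.
\<close>

definition finite_type_ideal :: "'i itself \<Rightarrow> 'a::unital_cstar_algebra set \<Rightarrow> bool" where
  "finite_type_ideal T F \<longleftrightarrow> subalgebra F \<and> selfadjoint_ideal F \<and>
     (\<exists>(I::'i set) le p. approx_unit_of_projs F I le p) \<and>
     (\<forall>p\<in>F. \<forall>q\<in>F. is_proj p \<longrightarrow> is_proj q \<longrightarrow>
        (\<exists>v. v * star v = q \<and> is_proj (star v * v + p)))"

definition invertible_up_to :: "'a::unital_cstar_algebra \<Rightarrow> 'a \<Rightarrow> 'a \<Rightarrow> bool" where
  "invertible_up_to a p q \<longleftrightarrow>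
     (let a' = (1 - q) * a * (1 - p) in
      \<exists>b. b = (1 - p) * b * (1 - q) \<and> a' * b = 1 - q \<and> b * a' = 1 - p)"

definition KPhi_plus :: "'a::unital_cstar_algebra set \<Rightarrow> 'a set" where
  "KPhi_plus F = {a. \<exists>p q. is_proj p \<and> is_proj q \<and> invertible_up_to a p q \<and> p \<in> F}"

definition KPhi_minus :: "'a::unital_cstar_algebra set \<Rightarrow> 'a set" where
  "KPhi_minus F = {a. \<exists>p q. is_proj p \<and> is_proj q \<and> invertible_up_to a p q \<and> q \<in> F}"

definition KPhi :: "'a::unital_cstar_algebra set \<Rightarrow> 'a set" where
  "KPhi F = {a. \<exists>p q. is_proj p \<and> is_proj q \<and> invertible_up_to a p q \<and> p \<in> F \<and> q \<in> F}"

definition KPhi_plus_minus :: "'a::unital_cstar_algebra set \<Rightarrow> 'a set" where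
  "KPhi_plus_minus F =
     {a. \<exists>p q. is_proj p \<and> is_proj q \<and> invertible_up_to a p q \<and> p \<in> F \<and> proj_subequiv p q}"

definition KPhi_minus_plus :: "'a::unital_cstar_algebra set \<Rightarrow> 'a set" where
  "KPhi_minus_plus F =
     {a. \<exists>p q. is_proj p \<and> is_proj q \<and> invertible_up_to a p q \<and> q \<in> F \<and> proj_subequiv q p}"

definition KPhi_zero :: "'a::unital_cstar_algebra set \<Rightarrow> 'a set" where
  "KPhi_zero F =
     {a. \<exists>p q. is_proj p \<and> is_proj q \<and> invertible_up_to a p q \<and> p \<in> F \<and> q \<in> F \<and> proj_equiv p q}"

end

theory Submission imports Defs begin

text \<open>
  Invertibility up to a fixed pair \<open>(p, q)\<close> is an open condition. Hence all the sets involved are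
  open, and if \<open>a\<close> lies on the boundary of one of them and is invertible up to \<open>(p, q)\<close>, then some
  \<open>c\<close> in that set is invertible up to the same \<open>(p, q)\<close>; a pair \<open>(p', q')\<close> witnessing the membership
  of \<open>c\<close> has to be turned into one for \<open>a\<close>. For the Fredholm set, \<open>q \<in> F\<close> follows by
  comparing one-sided inverses of \<open>c\<close> modulo \<open>F\<close>. For the Weyl sets, choose a projection
  \<open>P \<in> F\<close> almost dominating \<open>p\<close> and \<open>p'\<close>. With \<open>E\<close> an idempotent complementary to the range of
  \<open>c (1 - P)\<close>, one has \<open>P \<oplus> q \<sim> E \<oplus> p\<close> and \<open>P \<oplus> q' \<sim> E \<oplus> p'\<close>, so \<open>p' \<preceq> q'\<close> implies
  \<open>p \<oplus> e \<preceq> q \<oplus> e\<close> for \<open>e = P \<oplus> p'\<close>. Axiom (iii) realises \<open>e\<close> orthogonally to \<open>p\<close>, and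
  \<open>a\<close> is invertible up to \<open>(p + e, q + f)\<close>, where \<open>f \<sim> e\<close> is the range projection of
  \<open>(1 - q) a e\<close>. The equivalences obtained are algebraic; they become equivalences by partial
  isometries through polar decomposition of elements of \<open>F\<close>.
\<close>

subsection \<open>Square roots and inverses near the identity\<close>

lemma star_zero [simp]: "star (0::'a::unital_cstar_algebra) = 0"
  using star_add[of "0::'a" 0] by simp

lemma star_one [simp]: "star (1::'a::unital_cstar_algebra) = 1"
  by (metis mult_1_left mult_1_right star_mult star_star)

lemma star_scaleR: "star (r *\<^sub>R (x::'a::unital_cstar_algebra)) = r *\<^sub>R star x"
  by (metis complex_cnj_complex_of_real scaleC_of_real star_scaleC)

lemma star_minus: "star (- (x::'a::unital_cstar_algebra)) = - star x"
  using star_scaleR[of "-1" x] by simp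

lemma star_diff: "star ((x::'a::unital_cstar_algebra) - y) = star x - star y"
  using star_add[of x "- y"] by (simp add: star_minus)

lemma norm_star_le: "norm (x::'a::unital_cstar_algebra) \<le> norm (star x)"
proof (cases "x = 0")
  case False
  have "norm x * norm x \<le> norm (star x) * norm x"
    using norm_mult_ineq[of "star x" x] by (simp add: cstar_identity power2_eq_square)
  then show ?thesis using False by simp
qed simp

lemma norm_star [simp]: "norm (star x) = norm (x::'a::unital_cstar_algebra)"
  by (metis antisym norm_star_le star_star)

lemma bounded_linear_star: "bounded_linear (star :: 'a::unital_cstar_algebra \<Rightarrow> 'a)"
  by (rule bounded_linear_intro[where K = 1]) (auto simp: star_add star_scaleR)

lemma is_projD:
  assumes "is_proj p"
  shows "p * p = p" "star p = p" "p * (p * x) = p * x"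
  using assms by (simp_all add: is_proj_def flip: mult.assoc)

lemma is_proj_compl: "is_proj p \<Longrightarrow> is_proj (1 - p)"
  by (simp add: is_proj_def star_diff algebra_simps)

lemma norm_proj_le: "is_proj p \<Longrightarrow> norm p \<le> 1"
proof -
  assume p: "is_proj p"
  have "norm p * norm p = norm p"
    using cstar_identity[of p] is_projD[OF p] by (simp add: power2_eq_square)
  then show ?thesis by (metis mult_cancel_right1 norm_zero order_refl zero_le_one)
qed

lemma norm_one_le: "norm (1::'a::unital_cstar_algebra) \<le> 1"
  by (rule norm_proj_le) (simp add: is_proj_def)

lemma norm_le_one_if_proj: "is_proj (star v * v) \<Longrightarrow> norm v \<le> 1"
  using norm_proj_le[of "star v * v"] by (simp add: cstar_identity power_le_one_iff abs_square_le_1)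

lemma norm_mult_le: "norm (x::'a::real_normed_algebra) \<le> a \<Longrightarrow> norm y \<le> b \<Longrightarrow> norm (x * y) \<le> a * b"
  by (meson mult_mono norm_ge_zero norm_mult_ineq order_trans)

section \<open>Inverses of perturbations of the identity, also in corners\<close>

lemma neumann_right:
  fixes x :: "'a::unital_cstar_algebra"
  assumes "norm x < 1"
  shows "\<exists>y. (1 - x) * y = 1"
proof -
  have "dist (1 + x * y) (1 + x * z) \<le> norm x * dist y z" for y z
    using norm_mult_ineq[of x "y - z"] by (simp add: dist_norm algebra_simps)
  then have "\<exists>!y. 1 + x * y = y"
    using assms by (intro banach_fix_type[of "norm x"]) auto
  then obtain y where "1 + x * y = y" by blast
  then have "(1 - x) * y = 1" by (simp add: algebra_simps)
  then show ?thesis by blast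
qed

lemma neumann:
  fixes x :: "'a::unital_cstar_algebra"
  assumes "norm x < 1"
  obtains y where "(1 - x) * y = 1" "y * (1 - x) = 1"
proof -
  obtain y where y: "(1 - x) * y = 1" using neumann_right[OF assms] by blast
  \<comment> \<open>The adjoint of a right inverse of \<open>1 - star x\<close> is a left inverse of
    \<open>1 - x\<close>, and the two one-sided inverses coincide.\<close>
  obtain z where z: "(1 - star x) * z = 1" using neumann_right[of "star x"] assms by auto
  have z': "star z * (1 - x) = 1"
    using arg_cong[OF z, of star] by (simp add: star_mult star_diff star_star)
  have "star z = y" by (metis mult.assoc mult_1_left mult_1_right y z')
  then show thesis using that y z' by simp
qed

text \<open>In the corner with unit \<open>e\<close> the inverse is the compression of the inverse
  of \<open>1 - w\<close>, which commutes with \<open>e\<close> because \<open>w\<close> does. The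
  bound comes from \<open>n = e + w * n\<close>.\<close>

lemma corner_neumann:
  fixes e w :: "'a::unital_cstar_algebra"
  assumes e: "is_proj e" and ew: "e * w = w" "w * e = w" and w: "norm w \<le> r" "r < 1"
  obtains n where "e * n = n" "n * e = n" "(e - w) * n = e" "n * (e - w) = e" "norm n \<le> 1 / (1 - r)"
proof -
  obtain y where y: "(1 - w) * y = 1" "y * (1 - w) = 1" using neumann[of w] w by auto
  have comm: "e * y = y * e"
  proof -
    have "e * y = y * ((1 - w) * e) * y" by (simp add: y flip: mult.assoc)
    also have "(1 - w) * e = e * (1 - w)" by (simp add: ew algebra_simps)
    also have "y * (e * (1 - w)) * y = y * e" by (simp add: y mult.assoc)
    finally show ?thesis .
  qed
  have ee: "e * e = e" using e by (simp add: is_projD)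
  define n where "n = e * y"
  have 1: "(e - w) = (1 - w) * e" "e - w = e * (1 - w)" by (simp_all add: ew algebra_simps)
  have n1: "e * n = n" by (simp add: n_def ee flip: mult.assoc)
  have n2: "n * e = n" by (metis comm ee mult.assoc n_def)
  have n3: "(e - w) * n = e" by (metis 1(1) comm ee mult.assoc mult_1_left n_def y(1))
  have n4: "n * (e - w) = e" by (metis 1(2) comm ee mult.assoc mult_1_right n_def y(2))
  have "n = e + w * n" using n3 n1 by (simp add: algebra_simps)
  then have "norm n \<le> norm e + norm (w * n)" by (metis norm_triangle_ineq)
  also have "\<dots> \<le> 1 + r * norm n"
    using norm_proj_le[OF e] norm_mult_le[OF w(1) order_refl, of n] by simp
  finally have "norm n \<le> 1 / (1 - r)" using w by (simp add: field_simps)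
  then show thesis using that n1 n2 n3 n4 by blast
qed

lemma corner_inverse_selfadjoint:
  fixes e h k :: "'a::unital_cstar_algebra"
  assumes "is_proj e" "star h = h" "h * k = e" "e * k = k"
  shows "star k = k"
proof -
  have kh: "star k * h = e"
    by (metis assms(1,2,3) is_projD(2) star_mult)
  have "star k = star k * e"
    by (metis assms(1,4) is_projD(2) star_mult)
  also have "\<dots> = (star k * h) * k" by (simp add: mult.assoc assms)
  also have "\<dots> = k" by (simp add: kh assms)
  finally show ?thesis .
qed

text \<open>The root is \<open>1 - y\<close> for the fixed point \<open>y\<close> of the contraction \<open>y \<mapsto> (x + y\<^sup>2) / 2\<close>.\<close>

lemma sqrt_one_minus:
  fixes x :: "'a::unital_cstar_algebra"
  assumes x: "norm x < 1" "star x = x"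
  obtains d where "d * d = 1 - x" "star d = d" "\<And>z. z * x = x * z \<Longrightarrow> z * d = d * z"
proof -
  define T where "T = (\<lambda>y. (1/2) *\<^sub>R (x + y * y))"
  \<comment> \<open>Selfadjointness and commutation with everything that commutes with
    \<open>x\<close> are closed conditions preserved by \<open>T\<close>; building them into
    \<open>S\<close> passes them to the fixed point.\<close>
  define S where "S = cball 0 (norm x) \<inter> ({y. star y = y} \<inter> (\<Inter>z\<in>{z. z * x = x * z}. {y. z * y = y * z}))"
  have "\<exists>!y\<in>S. T y = y"
  proof (rule Banach_fix[of _ "norm x"])
    have "closed {y::'a. star y = y}"
      by (intro closed_Collect_eq continuous_intros
          linear_continuous_on[OF bounded_linear_star])
    moreover have "closed {y. z * y = y * z}" for z :: 'a
      by (intro closed_Collect_eq continuous_intros)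
    ultimately have "closed S" unfolding S_def by (intro closed_Int closed_INT ballI closed_cball)
    then show "complete S" by (simp add: complete_eq_closed)
    show "S \<noteq> {}" 
    proof -
      have "0 \<in> S" by (simp add: S_def)
      then show ?thesis by blast
    qed
    show "T ` S \<subseteq> S"
    proof (clarify)
      fix y assume y: "y \<in> S"
      have ny: "norm y \<le> norm x" and sy: "star y = y" and cy: "\<And>z. z * x = x * z \<Longrightarrow> z * y = y * z"
        using y by (auto simp: S_def)
      have "norm (y * y) \<le> norm x * 1" by (rule norm_mult_le) (use ny x in auto)
      then have "norm (T y) \<le> norm x"
        using norm_triangle_ineq[of x "y * y"] by (simp add: T_def)
      moreover have "star (T y) = T y"
        by (simp add: T_def star_scaleR star_add star_mult sy x)
      moreover have "z * T y = T y * z" if "z * x = x * z" for z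
      proof -
        have "z * (y * y) = y * y * z" by (metis cy[OF that] mult.assoc)
        then show ?thesis by (simp add: T_def that distrib_left distrib_right)
      qed
      ultimately show "T y \<in> S" by (auto simp: S_def)
    qed
    show "dist (T y) (T z) \<le> norm x * dist y z" if "y \<in> S" "z \<in> S" for y z
    proof -
      have n: "norm y \<le> norm x" "norm z \<le> norm x" using that by (auto simp: S_def)
      have "y * y - z * z = y * (y - z) + (y - z) * z" by (simp add: algebra_simps)
      then have "norm (y * y - z * z) \<le> norm (y * (y - z)) + norm ((y - z) * z)"
        by (metis norm_triangle_ineq)
      also have "\<dots> \<le> norm x * norm (y - z) + norm (y - z) * norm x"
        by (intro add_mono norm_mult_le n order_refl)
      finally have *: "norm (y * y - z * z) \<le> 2 * (norm x * norm (y - z))" by simp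
      have "T y - T z = (1/2) *\<^sub>R (y * y - z * z)"
        by (simp add: T_def flip: scaleR_diff_right)
      then show ?thesis using * by (simp add: dist_norm)
    qed
  qed (use x in auto)
  then obtain y where y: "y \<in> S" "T y = y" by blast
  have "2 *\<^sub>R T y = x + y * y" by (simp add: T_def)
  then have yy: "y + y = x + y * y" using y by (simp add: scaleR_2)
  have "(1 - y) * (1 - y) = 1 - (y + y) + y * y" by (simp add: algebra_simps)
  then have "(1 - y) * (1 - y) = 1 - x" by (simp add: yy)
  moreover have "star (1 - y) = 1 - y" using y by (simp add: S_def star_diff)
  moreover have "z * (1 - y) = (1 - y) * z" if "z * x = x * z" for z
    using y that by (simp add: S_def algebra_simps)
  ultimately show thesis using that by blast
qed

text \<open>
  With \<open>d = sqrt (1 - s\<^sup>2)\<close> the element \<open>s + \<i> d\<close> is unitary, so its imaginary part \<open>d\<close> has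
  norm at most 1.
\<close>

lemma norm_one_minus_square_le:
  fixes s :: "'a::unital_cstar_algebra"
  assumes s: "star s = s" "norm s < 1"
  shows "norm (1 - s * s) \<le> 1"
proof -
  have "norm (s * s) < 1"
    using cstar_identity[of s] s by (simp add: power_less_one_iff abs_square_less_1)
  then obtain d where d: "d * d = 1 - s * s" "star d = d" "s * d = d * s"
    using sqrt_one_minus[of "s * s"] s by (metis mult.assoc star_mult)
  define u where "u = s + scaleC \<i> d"
  have su: "star u = s - scaleC \<i> d"
  proof -
    have "scaleC (-1) (scaleC \<i> d) = - scaleC \<i> d"
      using scaleC_of_real[of "-1" "scaleC \<i> d"] by simp
    then have "scaleC (- \<i>) d = - scaleC \<i> d" by (simp add: scaleC_scaleC)
    then show ?thesis by (simp add: u_def star_add star_scaleC s d)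
  qed
  have ii: "scaleC \<i> d * scaleC \<i> d = - (d * d)"
    using scaleC_of_real[of "-1" "d * d"] by (simp add: mult_scaleC_left mult_scaleC_right scaleC_scaleC)
  have "star u * u = s * s + (scaleC \<i> (s * d) - scaleC \<i> (d * s)) - scaleC \<i> d * scaleC \<i> d"
  proof -
    have "(s - i) * (s + i) = s * s + (s * i - i * s) - i * i" for i :: 'a
      by (simp add: algebra_simps)
    from this[of "scaleC \<i> d"] show ?thesis
      unfolding su unfolding u_def by (simp add: mult_scaleC_left mult_scaleC_right)
  qed
  also have "\<dots> = 1" by (simp add: ii d)
  finally have uu: "star u * u = 1" .
  have "norm u \<le> 1" by (rule norm_le_one_if_proj) (simp add: uu is_proj_def)
  have "u - star u = 2 *\<^sub>R scaleC \<i> d" unfolding su by (simp add: u_def scaleR_2)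
  then have "2 * norm d = norm (u - star u)" by (simp add: norm_scaleC)
  also have "\<dots> \<le> norm u + norm (star u)" by (rule norm_triangle_ineq4)
  finally have "norm d \<le> 1" using \<open>norm u \<le> 1\<close> by simp
  then have "norm (d * d) \<le> 1 * 1" by (intro norm_mult_le)
  then show ?thesis by (simp add: d)
qed

text \<open>The element \<open>x\<close> is off-diagonal with respect to \<open>g\<close>, so
  compressing the square of the selfadjoint \<open>s = x + star x\<close> to \<open>g\<close> leaves
  \<open>star x * x\<close>. The bound 1/2 guarantees \<open>norm s < 1\<close>.\<close>

lemma norm_proj_minus_square_le:
  fixes x g :: "'a::unital_cstar_algebra"
  assumes g: "is_proj g" and x: "x * g = x" "g * x = 0" "norm x < 1/2"
  shows "norm (g - star x * x) \<le> 1"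
proof -
  define s where "s = x + star x"
  have gx: "g * star x = star x"
    using arg_cong[OF x(1), of star] g by (simp add: star_mult is_projD)
  have "star x * g = 0"
    using arg_cong[OF x(2), of star] g by (simp add: star_mult is_projD)
  have gs: "g * s = star x" by (simp add: s_def distrib_left x gx)
  have sg: "s * g = x" by (simp add: s_def distrib_right x \<open>star x * g = 0\<close>)
  have "norm s \<le> norm x + norm (star x)" unfolding s_def by (rule norm_triangle_ineq)
  then have "norm s < 1" using x by simp
  then have 1: "norm (1 - s * s) \<le> 1"
    by (intro norm_one_minus_square_le) (simp_all add: s_def star_add star_star)
  have "g * (1 - s * s) * g = g * g - (g * s) * (s * g)" by (simp add: algebra_simps)
  then have "g - star x * x = g * (1 - s * s) * g" using g by (simp add: gs sg is_projD)
  also have "norm \<dots> \<le> 1 * 1 * 1" by (intro norm_mult_le 1 norm_proj_le g)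
  finally show ?thesis by simp
qed


subsection \<open>Polar decomposition inside an ideal of finite type elements\<close>

lemma finite_type_idealD:
  assumes F: "finite_type_ideal TYPE('i) F"
  shows ideal_mult_left: "b \<in> F \<Longrightarrow> a * b \<in> F" and ideal_mult_right: "b \<in> F \<Longrightarrow> b * a \<in> F"
    and ideal_add: "b \<in> F \<Longrightarrow> c \<in> F \<Longrightarrow> b + c \<in> F" and ideal_diff: "b \<in> F \<Longrightarrow> c \<in> F \<Longrightarrow> b - c \<in> F"
    and ideal_star: "b \<in> F \<Longrightarrow> star b \<in> F"
proof -
  show 1: "b \<in> F \<Longrightarrow> a * b \<in> F" "b \<in> F \<Longrightarrow> b * a \<in> F" "b \<in> F \<Longrightarrow> star b \<in> F" for a b
    using F by (auto simp: finite_type_ideal_def selfadjoint_ideal_def)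
  show 2: "b \<in> F \<Longrightarrow> c \<in> F \<Longrightarrow> b + c \<in> F" for b c
    using F by (auto simp: finite_type_ideal_def subalgebra_def)
  show "b \<in> F \<Longrightarrow> c \<in> F \<Longrightarrow> b - c \<in> F"
    using 2[of b "(- 1) * c"] 1(1)[of c "- 1"] by simp
qed

text \<open>Two elements are treated at once because a single \<open>P\<close> will have to almost
  dominate two projections.\<close>

lemma ideal_approx_proj:
  assumes F: "finite_type_ideal TYPE('i) F" and xy: "x \<in> F" "y \<in> F" "0 < \<epsilon>"
  obtains P where "P \<in> F" "is_proj P" "norm (x * P - x) < \<epsilon>" "norm (y * P - y) < \<epsilon>"
proof -
  obtain I :: "'i set" and le p where "approx_unit_of_projs F I le p"
    using F by (auto simp: finite_type_ideal_def)
  then have dir: "directed_index I le" and p: "\<And>i. i \<in> I \<Longrightarrow> p i \<in> F \<and> is_proj (p i)"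
    and app: "\<And>x e. x \<in> F \<Longrightarrow> e > 0 \<Longrightarrow> \<exists>i\<in>I. \<forall>j\<in>I. le i j \<longrightarrow> norm (x * p j - x) < e"
    unfolding approx_unit_of_projs_def by blast+
  obtain i where i: "i \<in> I" "\<forall>j\<in>I. le i j \<longrightarrow> norm (x * p j - x) < \<epsilon>" using app xy by blast
  obtain j where j: "j \<in> I" "\<forall>k\<in>I. le j k \<longrightarrow> norm (y * p k - y) < \<epsilon>" using app xy by blast
  obtain k where "k \<in> I" "le i k" "le j k" using dir i(1) j(1) unfolding directed_index_def by blast
  then show thesis using that p i j by blast
qed

text \<open>Multiplying \<open>g * P + P * g = 0\<close> by \<open>g\<close> on either side shows
  that both terms equal \<open>- g * P * g\<close>; being equal with sum 0, they vanish.\<close>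

lemma proj_orthogonal_if_sum_proj:
  fixes g P :: "'a::unital_cstar_algebra"
  assumes g: "is_proj g" and P: "is_proj P" and gP: "is_proj (g + P)"
  shows "g * P = 0" "P * g = 0"
proof -
  have "(g + P) * (g + P) = g + P" using gP by (simp add: is_proj_def)
  then have z: "g * P + P * g = 0" using g P by (simp add: distrib_left distrib_right is_projD algebra_simps)
  have 1: "g * P + g * P * g = 0"
    using arg_cong[OF z, of "\<lambda>x. g * x"] g by (simp add: distrib_left is_projD mult.assoc)
  have 2: "g * P * g + P * g = 0"
    using arg_cong[OF z, of "\<lambda>x. x * g"] g by (simp add: distrib_right is_projD mult.assoc)
  have e: "g * P = P * g" using 1 2 by (metis add.commute add_left_imp_eq)
  have "(2::real) *\<^sub>R (g * P) = 0" using z e by (simp add: scaleR_2)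
  then show "g * P = 0" by simp
  then show "P * g = 0" using e by simp
qed

text \<open>The defect \<open>w = star v - star v * (v * star v)\<close> satisfies
  \<open>star w * w = 0\<close> and vanishes by the C*-identity.\<close>

lemma partial_isometry:
  fixes v :: "'a::unital_cstar_algebra"
  assumes e: "is_proj (v * star v)"
  shows "v * star v * v = v" "is_proj (star v * v)"
proof -
  let ?e = "v * star v" let ?w = "star v - star v * ?e"
  have ee: "?e * ?e = ?e" using e is_projD by blast
  have "star ?w * ?w = ?e - ?e * ?e - ?e * ?e + ?e * ?e * ?e"
    by (simp add: star_diff star_mult star_star algebra_simps)
  then have "star ?w * ?w = 0" by (simp add: ee)
  then have "norm ?w = 0" using cstar_identity[of ?w] by simp
  then have "star v = star v * ?e" by simp
  from arg_cong[OF this, of star] show 1: "v * star v * v = v"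
    by (simp add: star_mult star_star mult.assoc)
  have "star v * v * (star v * v) = star v * (v * star v * v)" by (simp add: mult.assoc)
  then show "is_proj (star v * v)" by (simp add: is_proj_def 1 star_mult star_star)
qed

text \<open>This is axiom (iii) with its sum condition turned into orthogonality; the copy stays in
  \<open>F\<close> because \<open>v = e * v\<close> does.\<close>

lemma ideal_orthogonal_copy:
  assumes F: "finite_type_ideal TYPE('i) F" and P: "P \<in> F" "is_proj P" and e: "e \<in> F" "is_proj e"
  obtains v where "v * star v = e" "e * v = v" "is_proj (star v * v)" "star v * v \<in> F"
    "star v * v * P = 0" "P * (star v * v) = 0"
proof -
  obtain v where v: "v * star v = e" "is_proj (star v * v + P)"
    using F P e unfolding finite_type_ideal_def by blast
  have ev: "e * v = v" and g: "is_proj (star v * v)" using partial_isometry[of v] v e by auto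
  have "v \<in> F" using ideal_mult_right[OF F e(1), of v] ev by simp
  then have "star v * v \<in> F" by (rule ideal_mult_left[OF F])
  then show thesis using that v ev g proj_orthogonal_if_sum_proj[OF g P(2) v(2)] by blast
qed

text \<open>
  Positivity of \<open>star y * y\<close> without functional calculus: move \<open>e\<close> to a projection orthogonal to
  the (approximate) range of \<open>y\<close>; there \<open>star y * y\<close> is a corner of the square of a selfadjoint element.
\<close>

lemma norm_proj_minus_star_mult_le:
  assumes F: "finite_type_ideal TYPE('i) F" and e: "e \<in> F" "is_proj e"
    and y: "y \<in> F" "y * e = y" "norm y < 1/2"
  shows "norm (e - star y * y) \<le> 1"
proof (rule field_le_epsilon)
  fix \<epsilon> :: real assume "0 < \<epsilon>"
  obtain P where P: "P \<in> F" "is_proj P" "norm (star y * P - star y) < \<epsilon>"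
    using ideal_approx_proj[OF F ideal_star[OF F y(1)] ideal_star[OF F y(1)] \<open>0 < \<epsilon>\<close>] by blast
  obtain v where v: "v * star v = e" "e * v = v" "is_proj (star v * v)" "star v * v * P = 0"
    using ideal_orthogonal_copy[OF F P(1,2) e] by metis
  define g where "g = star v * v"
  \<comment> \<open>A transport of the approximation \<open>P * y\<close> of \<open>y\<close> from
    \<open>e\<close> to \<open>g\<close>. Orthogonality of \<open>g\<close> and \<open>P\<close>
    makes it off-diagonal: \<open>x * g = x\<close> and \<open>g * x = 0\<close>.\<close>
  define x where "x = P * y * v"
  have nv: "norm v \<le> 1" using v norm_le_one_if_proj by blast
  have vg: "v * g = v" using v by (simp add: g_def flip: mult.assoc)
  have sye: "e * star y = star y" by (metis e(2) is_projD(2) star_mult y(2))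
  have sx: "star x = star v * star y * P" using P by (simp add: x_def star_mult is_projD mult.assoc)
  have "norm (P * y) \<le> 1 * norm y" by (intro norm_mult_le norm_proj_le P order_refl)
  then have "norm x \<le> norm y * 1" unfolding x_def by (intro norm_mult_le nv) simp
  then have "norm (g - star x * x) \<le> 1"
    using v(3) y(3) by (intro norm_proj_minus_square_le)
      (simp_all add: g_def x_def vg[unfolded g_def] mult.assoc, simp add: v(4) flip: mult.assoc)
  then have "norm (v * (g - star x * x) * star v) \<le> 1 * 1 * 1"
    using nv by (intro norm_mult_le) auto
  moreover have "v * (g - star x * x) * star v = e - star y * P * y"
  proof -
    have "v * (star x * x) * star v = (v * star v) * star y * (P * P) * y * (v * star v)"
      unfolding sx by (simp add: x_def mult.assoc)
    also have "\<dots> = star y * P * y"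
      using P y by (simp add: v(1) sye is_projD mult.assoc)
    finally show ?thesis using v(1) vg by (simp add: right_diff_distrib left_diff_distrib)
  qed
  ultimately have 1: "norm (e - star y * P * y) \<le> 1" by simp
  have "norm ((star y * P - star y) * y) \<le> \<epsilon> * 1" using P y by (intro norm_mult_le) auto
  moreover have "e - star y * y = (e - star y * P * y) + (star y * P - star y) * y"
    by (simp add: algebra_simps)
  ultimately show "norm (e - star y * y) \<le> 1 + \<epsilon>"
    using 1 norm_triangle_le[of "e - star y * P * y" "(star y * P - star y) * y" "1 + \<epsilon>"] by (smt (verit))
qed

text \<open>Positivity of \<open>h = star y * y\<close>, in the form
  \<open>norm (e - h) \<le> 1\<close>, makes \<open>h + t e\<close> invertible in the corner of
  \<open>e\<close>. The left inverse \<open>z\<close> bounds that inverse independently of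
  \<open>t\<close>, so for small \<open>t\<close> a Neumann argument removes the shift.\<close>

lemma corner_inverse_star_mult:
  assumes F: "finite_type_ideal TYPE('i) F" and e: "e \<in> F" "is_proj e"
    and y: "y \<in> F" "y * e = y" "norm y < 1/2" "z * y = e"
  obtains k where "e * k = k" "k * e = k" "star y * y * k = e" "k * (star y * y) = e" "star k = k"
proof -
  let ?h = "star y * y"
  have ee: "e * e = e" and se: "star e = e" using e by (simp_all add: is_projD)
  have ehe: "e * star y = star y" by (metis se star_mult y(2))
  have eh: "e * ?h = ?h" "?h * e = ?h" by (metis ehe mult.assoc) (metis y(2) mult.assoc)
  have sh: "star ?h = ?h" by (simp add: star_mult star_star)
  \<comment> \<open>Chosen to make \<open>t\<close> times the later bound
    \<open>2 * (norm z)\<^sup>2\<close> on \<open>norm r\<close> at most 1/2; the summand 1 covers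
    \<open>z = 0\<close>.\<close>
  define t where "t = 1 / (4 * (norm z)\<^sup>2 + 1)"
  have t: "t > 0" unfolding t_def by (smt (verit) divide_pos_pos zero_le_power2)
  let ?W = "(1 / (1 + t)) *\<^sub>R (e - ?h)"
  have "norm ?W \<le> 1 / (1 + t)"
    using norm_proj_minus_star_mult_le[OF F e y(1-3)] t by (simp add: divide_right_mono)
  obtain n where n: "e * n = n" "n * e = n" "(e - ?W) * n = e" "n * (e - ?W) = e"
      "norm n \<le> 1 / (1 - 1 / (1 + t))"
  proof -
    have "e * ?W = ?W" "?W * e = ?W" by (simp_all add: right_diff_distrib left_diff_distrib eh ee)
    then show thesis using corner_neumann[OF e(2) _ _ \<open>norm ?W \<le> 1 / (1 + t)\<close>] that t by auto
  qed
  define r where "r = (1 / (1 + t)) *\<^sub>R n"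
  have er: "e * r = r" using n by (simp add: r_def)
  have "(1 + t) *\<^sub>R (e - ?W) = (1 + t) *\<^sub>R e - (e - ?h)"
    using t by (simp add: scaleR_diff_right)
  also have "\<dots> = ?h + t *\<^sub>R e" by (simp add: scaleR_add_left)
  finally have ht: "?h + t *\<^sub>R e = (1 + t) *\<^sub>R (e - ?W)" by simp
  have hr: "(?h + t *\<^sub>R e) * r = e"
    unfolding ht r_def using n(3) t by simp
  have sr: "star r = r"
    by (rule corner_inverse_selfadjoint[OF e(2) _ hr er]) (simp only: star_add star_scaleR sh se)
  have hr': "?h * r = e - t *\<^sub>R r" using hr er by (simp add: distrib_right algebra_simps)
  have "norm r \<le> (1 / (1 + t)) * (1 / (1 - 1 / (1 + t)))"
    using mult_left_mono[OF n(5), of "1 / (1 + t)"] t unfolding r_def by simp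
  also have "\<dots> = 1 / t" using t by (simp add: field_simps)
  finally have tr: "t * norm r \<le> 1" using t by (simp add: field_simps)
  \<comment> \<open>Here the left inverse enters: \<open>r = z * (y * r)\<close>, while the
    C*-identity gives \<open>(norm (y * r))\<^sup>2 \<le> 2 * norm r\<close>. After squaring, one
    factor \<open>norm r\<close> cancels.\<close>
  have "norm r \<le> 2 * (norm z)\<^sup>2"
  proof (cases "r = 0")
    case False
    have re: "r * e = r" using n by (simp add: r_def)
    have "star (y * r) * (y * r) = r * (?h * r)" by (simp add: star_mult sr mult.assoc)
    also have "\<dots> = r - t *\<^sub>R (r * r)" by (simp add: hr' right_diff_distrib re)
    finally have "(norm (y * r))\<^sup>2 = norm (r - t *\<^sub>R (r * r))" by (metis cstar_identity)
    also have "\<dots> \<le> norm r + t * norm (r * r)"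
      using norm_triangle_ineq4[of r "t *\<^sub>R (r * r)"] t by simp
    also have "\<dots> \<le> norm r + t * (norm r * norm r)"
      using t by (intro add_left_mono mult_left_mono norm_mult_ineq) auto
    also have "\<dots> \<le> norm r + norm r"
      using mult_right_mono[OF tr norm_ge_zero[of r]] by (simp add: mult.assoc)
    finally have yr: "(norm (y * r))\<^sup>2 \<le> 2 * norm r" by simp
    have "r = z * (y * r)" by (simp add: y(4) er flip: mult.assoc)
    then have "norm r \<le> norm z * norm (y * r)" by (metis norm_mult_ineq)
    then have "(norm r)\<^sup>2 \<le> (norm z * norm (y * r))\<^sup>2" by (intro power_mono) auto
    also have "\<dots> \<le> (norm z)\<^sup>2 * (2 * norm r)"
      unfolding power_mult_distrib by (intro mult_left_mono yr) auto
    finally show ?thesis using False by (simp add: power2_eq_square)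
  qed simp
  then have "t * norm r \<le> t * (2 * (norm z)\<^sup>2)" using t by (intro mult_left_mono) auto
  also have "\<dots> \<le> 1/2" unfolding t_def by (simp add: field_simps add_pos_nonneg)
  finally have "norm (t *\<^sub>R r) \<le> 1/2" using t by simp
  \<comment> \<open>Thus \<open>h * r = e - t r\<close> has an inverse \<open>m\<close> in the
    corner, and \<open>r * m\<close> inverts \<open>h\<close>.\<close>
  then obtain m where m: "e * m = m" "m * e = m" "(e - t *\<^sub>R r) * m = e"
    using corner_neumann[of e "t *\<^sub>R r" "1/2"] e(2) er n by (auto simp: r_def)
  define k where "k = r * m"
  have k: "e * k = k" "k * e = k" by (metis er k_def mult.assoc) (metis m(2) k_def mult.assoc)
  have hk: "?h * k = e" using hr' m by (simp add: k_def flip: mult.assoc)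
  have sk: "star k = k" by (rule corner_inverse_selfadjoint[OF e(2) sh hk k(1)])
  have "k * ?h = e" by (metis hk se sh sk star_mult)
  then show thesis using that k hk sk by blast
qed

text \<open>The isometric factor is \<open>y * h^(-1/2)\<close> with \<open>h = star y * y\<close>,
  the root being formed in the corner of \<open>e\<close>. Extracting it requires the strict bound
  \<open>norm (e - h) < 1\<close>, which is derived from the invertibility of \<open>h\<close> in
  that corner.\<close>

lemma polar_decomposition_small:
  assumes F: "finite_type_ideal TYPE('i) F" and e: "e \<in> F" "is_proj e"
    and y: "y \<in> F" "y * e = y" "norm y < 1/4" "z * y = e"
  shows "\<exists>u w w'. star u * u = e \<and> u = y * w \<and> y = u * w'"
proof -
  define h where "h = star y * y"
  have ee: "e * e = e" and se: "star e = e" using e by (simp_all add: is_projD)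
  have sh: "star h = h" by (simp add: h_def star_mult star_star)
  have eh: "e * h = h" "h * e = h" 
    by (metis h_def mult.assoc se star_mult y(2)) (simp add: h_def y mult.assoc)
  have "norm y < 1/2" using y(3) by simp
  from corner_inverse_star_mult[OF F e y(1,2) this y(4), folded h_def]
  obtain k where k: "e * k = k" "k * e = k" "h * k = e" "k * h = e" "star k = k" by blast
  define \<tau> where "\<tau> = 1 / (4 * (1 + norm k))"
  have \<tau>: "0 < \<tau>" "\<tau> \<le> 1/4" "\<tau> * norm k < 1/4"
    unfolding \<tau>_def by (simp_all add: field_simps add_pos_nonneg)
  \<comment> \<open>\<open>h - \<tau> e = star (y * d) * (y * d)\<close> is again positive, which bounds \<open>h\<close> away from 0.\<close>
  have "norm (\<tau> *\<^sub>R k) < 1" "star (\<tau> *\<^sub>R k) = \<tau> *\<^sub>R k" using \<tau> k(5) by (simp_all add: star_scaleR)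
  from sqrt_one_minus[OF this]
  obtain d where d: "d * d = 1 - \<tau> *\<^sub>R k" "star d = d"
      "\<And>z. z * (\<tau> *\<^sub>R k) = \<tau> *\<^sub>R k * z \<Longrightarrow> z * d = d * z" by blast
  have hd: "h * d = d * h" and ed: "e * d = d * e" using k by (auto intro!: d(3))
  let ?y = "y * d"
  have "star ?y * ?y = d * h * d" by (simp add: star_mult d h_def mult.assoc)
  also have "\<dots> = h * (d * d)" by (metis hd mult.assoc)
  also have "\<dots> = h - \<tau> *\<^sub>R e" by (simp add: d right_diff_distrib k)
  finally have yd: "star ?y * ?y = h - \<tau> *\<^sub>R e" .
  have nh: "norm h \<le> 1/16"
  proof -
    have "norm h = (norm y)\<^sup>2" by (simp add: h_def cstar_identity)
    also have "\<dots> \<le> (1/4)\<^sup>2" using y by (intro power_mono) auto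
    finally show ?thesis by (simp add: power2_eq_square)
  qed
  have "h - \<tau> *\<^sub>R e = h * (1 - \<tau> *\<^sub>R k)" by (simp add: right_diff_distrib k)
  moreover have "norm (1 - \<tau> *\<^sub>R k) \<le> 2"
    using norm_triangle_ineq4[of 1 "\<tau> *\<^sub>R k"] norm_one_le[where ?'a='a] \<tau> by simp
  ultimately have "norm (h - \<tau> *\<^sub>R e) \<le> 1/16 * 2" using nh norm_mult_le by metis
  then have nyd: "(norm ?y)\<^sup>2 \<le> 1/8" using cstar_identity[of ?y] by (simp add: yd)
  \<comment> \<open>With this scaling, \<open>e - star (c y d) * (c y d)\<close> becomes
    \<open>(e - h) / (1 - \<tau>)\<close>, so the bound 1 for it yields
    \<open>norm (e - h) \<le> 1 - \<tau>\<close>.\<close>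
  define c where "c = 1 / sqrt (1 - \<tau>)"
  have c2: "c * c = 1 / (1 - \<tau>)" using \<tau> by (simp add: c_def)
  have "norm (e - star (c *\<^sub>R ?y) * (c *\<^sub>R ?y)) \<le> 1"
  proof (rule norm_proj_minus_star_mult_le[OF F e])
    show "c *\<^sub>R ?y \<in> F" using ideal_mult_right[OF F y(1), of "c *\<^sub>R d"] by simp
    show "c *\<^sub>R ?y * e = c *\<^sub>R ?y" using ed y(2) by (metis mult.assoc mult_scaleR_left)
    have "(norm (c *\<^sub>R ?y))\<^sup>2 = (norm ?y)\<^sup>2 / (1 - \<tau>)"
      using \<tau> by (simp add: power_mult_distrib power_divide c_def)
    also have "\<dots> \<le> 1/8 / (3/4)" using nyd \<tau> by (intro frac_le) auto
    also have "\<dots> < (1/2)\<^sup>2" by (simp add: power2_eq_square)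
    finally show "norm (c *\<^sub>R ?y) < 1/2" by (rule power2_less_imp_less) simp
  qed
  moreover have "e - star (c *\<^sub>R ?y) * (c *\<^sub>R ?y) = (1 / (1 - \<tau>)) *\<^sub>R (e - h)"
  proof -
    have "star (c *\<^sub>R ?y) * (c *\<^sub>R ?y) = (c * c) *\<^sub>R (star ?y * ?y)" by (simp add: star_scaleR)
    then have "(1 - \<tau>) *\<^sub>R (e - star (c *\<^sub>R ?y) * (c *\<^sub>R ?y)) = (1 - \<tau>) *\<^sub>R e - (h - \<tau> *\<^sub>R e)"
      using \<tau> by (simp add: yd c2 scaleR_diff_right)
    also have "\<dots> = e - h" by (simp add: scaleR_diff_left)
    finally have "(1 / (1 - \<tau>)) *\<^sub>R (1 - \<tau>) *\<^sub>R (e - star (c *\<^sub>R ?y) * (c *\<^sub>R ?y)) = (1 / (1 - \<tau>)) *\<^sub>R (e - h)"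
      by (rule arg_cong)
    then show ?thesis using \<tau> by (simp del: scaleR_diff_right)
  qed
  ultimately have "norm ((1 / (1 - \<tau>)) *\<^sub>R (e - h)) \<le> 1" by (simp only:)
  then have "norm (e - h) \<le> 1 - \<tau>" using \<tau> by simp
  then have "norm (e - h) < 1" "star (e - h) = e - h" using \<tau> by (simp_all add: star_diff se sh)
  from sqrt_one_minus[OF this] obtain d2 where d2: "d2 * d2 = 1 - (e - h)" "star d2 = d2"
      "\<And>z. z * (e - h) = (e - h) * z \<Longrightarrow> z * d2 = d2 * z" by blast
  have hd2: "h * d2 = d2 * h" and kd2: "k * d2 = d2 * k"
    using eh k by (auto intro!: d2(3) simp: algebra_simps)
  \<comment> \<open>As \<open>d2 * d2 = (1 - e) + h\<close>, on the corner \<open>d2\<close> acts as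
    the root of \<open>h\<close>, and \<open>d2 * k\<close> is the inverse of that root.\<close>
  define u where "u = y * (d2 * k)"
  have "star u * u = k * d2 * h * d2 * k"
    by (simp add: u_def star_mult d2 k h_def mult.assoc)
  also have "\<dots> = k * h * (d2 * d2) * k" by (metis hd2 mult.assoc)
  also have "\<dots> = e * (1 - (e - h)) * k" by (simp add: d2 k)
  also have "\<dots> = e" by (simp add: algebra_simps ee eh k)
  finally have "star u * u = e" .
  moreover have "y = u * d2"
  proof -
    have "u * d2 = y * (k * (d2 * d2))" unfolding u_def by (metis kd2 mult.assoc)
    also have "k * (d2 * d2) = e" by (simp add: d2 algebra_simps k)
    finally show ?thesis by (simp add: y)
  qed
  ultimately show ?thesis using u_def by blast
qed

lemma polar_decomposition:
  assumes F: "finite_type_ideal TYPE('i) F" and e: "e \<in> F" "is_proj e"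
    and y: "y \<in> F" "y * e = y" "z * y = e"
  obtains u w w' where "star u * u = e" "u = y * w" "y = u * w'"
proof -
  define c where "c = 1 / (5 * (1 + norm y))"
  have c: "c > 0" unfolding c_def by (simp add: add_pos_nonneg)
  have "norm (c *\<^sub>R y) < 1/4" by (simp add: c_def field_simps add_pos_nonneg add_nonneg_pos)
  moreover have "c *\<^sub>R y \<in> F" using ideal_mult_right[OF F y(1), of "c *\<^sub>R 1"] by simp
  moreover have "c *\<^sub>R y * e = c *\<^sub>R y" "(1/c) *\<^sub>R z * (c *\<^sub>R y) = e" using y c by simp_all
  ultimately obtain u w w' where u: "star u * u = e" "u = c *\<^sub>R y * w" "c *\<^sub>R y = u * w'"
    using polar_decomposition_small[OF F e] by metis
  have "u = y * (c *\<^sub>R w)" using u(2) by simp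
  moreover have "y = (1/c) *\<^sub>R (c *\<^sub>R y)" using c by simp
  then have "y = u * ((1/c) *\<^sub>R w')" unfolding u(3) by simp
  ultimately show thesis using that u(1) by blast
qed

text \<open>\<open>f\<close> is \<open>u * star u\<close> for the polar part \<open>u\<close> of
  \<open>y\<close>. The equations \<open>f * y = y\<close> and \<open>f = y * m\<close> express that
  \<open>f\<close> and \<open>y\<close> generate the same right ideal.\<close>

lemma range_projection:
  assumes F: "finite_type_ideal TYPE('i) F" and e: "e \<in> F" "is_proj e"
    and y: "y \<in> F" "y * e = y" "z * y = e"
  obtains f m where "is_proj f" "f \<in> F" "proj_equiv e f" "f * y = y" "f = y * m"
proof -
  obtain u w w' where u: "star u * u = e" "u = y * w" "y = u * w'"
    using polar_decomposition[OF F e y] by blast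
  define f where "f = u * star u"
  have *: "is_proj (star u * star (star u))" using u(1) e(2) by (simp add: star_star)
  have f: "is_proj f" using partial_isometry(2)[OF *] by (simp add: f_def star_star)
  have fu: "f * u = u" using partial_isometry(1)[of u] f by (simp add: f_def)
  show thesis
  proof (rule that[of f "w * star u"])
    show "f \<in> F" unfolding f_def by (subst u(2)) (intro ideal_mult_right[OF F] y(1))
    show "proj_equiv e f" unfolding proj_equiv_def by (rule exI[of _ "star u"]) (simp add: star_star u(1) f_def)
    show "f * y = y" using fu u(3) by (metis mult.assoc)
    show "f = y * (w * star u)" unfolding f_def by (metis u(2) mult.assoc)
  qed (rule f)
qed


subsection \<open>Invertibility up to a pair of projections\<close>

text \<open>The corner condition on \<open>b\<close> amounts to \<open>p * b = 0\<close> and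
  \<open>b * q = 0\<close>; each of these absorbs one of the two cutoffs of
  \<open>a\<close>.\<close>

lemma invertible_up_to_iff:
  assumes p: "is_proj p" and q: "is_proj q"
  shows "invertible_up_to a p q \<longleftrightarrow>
    (\<exists>b. p * b = 0 \<and> b * q = 0 \<and> (1 - q) * a * b = 1 - q \<and> b * a * (1 - p) = 1 - p)"
proof -
  have "b = (1 - p) * b * (1 - q) \<longleftrightarrow> p * b = 0 \<and> b * q = 0" for b
  proof
    assume b: "b = (1 - p) * b * (1 - q)"
    have "p * ((1 - p) * b * (1 - q)) = 0" "(1 - p) * b * (1 - q) * q = 0"
      using p q by (simp_all add: algebra_simps is_projD)
    then show "p * b = 0 \<and> b * q = 0" using b by simp
  next
    assume "p * b = 0 \<and> b * q = 0"
    then show "b = (1 - p) * b * (1 - q)" by (simp add: algebra_simps)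
  qed
  moreover have "(1 - q) * a * (1 - p) * b = (1 - q) * a * b" if "p * b = 0" for b
    using that by (simp add: algebra_simps)
  moreover have "b * ((1 - q) * a * (1 - p)) = b * a * (1 - p)" if "b * q = 0" for b
  proof -
    have "b * ((1 - q) * a * (1 - p)) = (b - b * q) * a * (1 - p)"
      by (simp add: right_diff_distrib flip: mult.assoc)
    then show ?thesis using that by simp
  qed
  ultimately show ?thesis unfolding invertible_up_to_def Let_def by metis
qed

text \<open>Adjoints exchange the two projections, which reduces the lower cases to the upper
  ones.\<close>

lemma invertible_up_to_star:
  assumes p: "is_proj p" and q: "is_proj q" and a: "invertible_up_to a p q"
  shows "invertible_up_to (star a) q p"
proof -
  obtain b where b: "p * b = 0" "b * q = 0" "(1 - q) * a * b = 1 - q" "b * a * (1 - p) = 1 - p"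
    using a invertible_up_to_iff[OF p q] by blast
  have s: "star p = p" "star q = q" "star (1 - p) = 1 - p" "star (1 - q) = 1 - q"
    using p q by (simp_all add: is_projD star_diff)
  have "q * star b = 0" "star b * p = 0" using b(1,2) s by (metis star_mult star_zero)+
  moreover have "(1 - p) * star a * star b = 1 - p" using b(4) s by (metis star_mult mult.assoc)
  moreover have "star b * star a * (1 - q) = 1 - q" using b(3) s by (metis star_mult mult.assoc)
  ultimately show ?thesis using invertible_up_to_iff[OF q p] by blast
qed

lemma open_invertible_up_to:
  assumes p: "is_proj p" and q: "is_proj q"
  shows "open {a. invertible_up_to a p q}"
proof (rule openI, clarsimp)
  fix a assume "invertible_up_to a p q"
  then obtain b where b: "p * b = 0" "b * q = 0" "(1 - q) * a * b = 1 - q" "b * a * (1 - p) = 1 - p"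
    using invertible_up_to_iff[OF p q] by blast
  define \<epsilon> where "\<epsilon> = 1 / (1 + norm b)"
  have \<epsilon>: "\<epsilon> > 0" "\<epsilon> * norm b < 1" by (simp_all add: \<epsilon>_def add_pos_nonneg)
  have "invertible_up_to c p q" if "dist a c < \<epsilon>" for c
  proof -
    define D where "D = (1 - q) * (c - a) * (1 - p)"
    have "norm (c - a) \<le> \<epsilon>" using that by (simp add: dist_norm norm_minus_commute)
    then have "norm D \<le> 1 * \<epsilon> * 1"
      unfolding D_def by (intro norm_mult_le norm_proj_le is_proj_compl p q)
    then have D: "norm D \<le> \<epsilon>" by simp
    have "norm (b * D) \<le> norm b * \<epsilon>" "norm (D * b) \<le> \<epsilon> * norm b"
      by (intro norm_mult_le D order_refl)+
    then have n: "norm (- (b * D)) < 1" "norm (- (D * b)) < 1" using \<epsilon> by (simp_all add: mult.commute)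
    obtain N where N: "N * (1 + b * D) = 1" using neumann[OF n(1)] by auto
    obtain N' where N': "(1 + D * b) * N' = 1" using neumann[OF n(2)] by auto
    \<comment> \<open>From \<open>(1 + b * D) * b = b * (1 + D * b)\<close> the left and right
      corrections of \<open>b\<close> agree, so one element inverts on both sides.\<close>
    have "N * b = N * b * ((1 + D * b) * N')" by (simp add: N')
    also have "\<dots> = N * (1 + b * D) * b * N'" by (simp add: algebra_simps)
    finally have Nb: "N * b = b * N'" by (simp add: N)
    have "b * (1 - q) = b" "(1 - p) * b = b" using b by (simp_all add: algebra_simps)
    then have bD: "b * D = b * (c - a) * (1 - p)" and Db: "D * b = (1 - q) * (c - a) * b"
      unfolding D_def by (metis mult.assoc)+
    have qD: "(1 - q) * D = D" "D * (1 - p) = D"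
      using is_projD[OF is_proj_compl[OF p]] is_projD[OF is_proj_compl[OF q]]
      unfolding D_def by (metis mult.assoc)+
    have "(1 - q) * c * b = (1 - q) * a * b + D * b" unfolding Db by (simp add: algebra_simps)
    also have "\<dots> = (1 - q) * (1 + D * b)"
      unfolding b(3) distrib_left mult.assoc[symmetric] qD by simp
    finally have 1: "(1 - q) * c * (N * b) = 1 - q"
      unfolding Nb by (metis N' mult.assoc mult_1_right)
    have "b * c * (1 - p) = b * a * (1 - p) + b * D" unfolding bD by (simp add: algebra_simps)
    also have "\<dots> = (1 + b * D) * (1 - p)"
      unfolding b(4) by (simp add: distrib_right mult.assoc qD)
    finally have 2: "N * b * c * (1 - p) = 1 - p" by (metis N mult.assoc mult_1_left)
    have "p * (N * b) = 0" "N * b * q = 0" using b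
      by (metis Nb mult.assoc mult_zero_left) (simp add: b mult.assoc)
    then show ?thesis using 1 2 invertible_up_to_iff[OF p q] by blast
  qed
  then show "\<exists>e>0. ball a e \<subseteq> {a. invertible_up_to a p q}"
    using \<epsilon>(1) by (auto simp: ball_def)
qed

lemma is_proj_add:
  assumes "is_proj p" "is_proj e" "p * e = 0" "e * p = 0"
  shows "is_proj (p + e)"
  using assms by (simp add: is_proj_def star_add algebra_simps)

text \<open>Since \<open>e\<close> is orthogonal to \<open>p\<close>, \<open>b\<close> is a left
  inverse of \<open>(1 - q) * a\<close> on the range of \<open>e\<close>. Hence
  \<open>(1 - q) * a * e\<close> has a range projection \<open>f\<close> in \<open>F\<close>, and
  \<open>e\<close> and \<open>f\<close> can be split off together.\<close>

lemma invertible_up_to_extend: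
  assumes F: "finite_type_ideal TYPE('i) F" and p: "is_proj p" and q: "is_proj q"
    and a: "invertible_up_to a p q" and e: "e \<in> F" "is_proj e" "p * e = 0" "e * p = 0"
  obtains f where "is_proj f" "f \<in> F" "proj_equiv e f" "q * f = 0" "f * q = 0"
    "invertible_up_to a (p + e) (q + f)"
proof -
  obtain b where b: "p * b = 0" "b * q = 0" "(1 - q) * a * b = 1 - q" "b * a * (1 - p) = 1 - p"
    using a invertible_up_to_iff[OF p q] by blast
  have ee: "e * e = e" using e by (simp add: is_projD)
  have pe: "(1 - p) * e = e" using e by (simp add: algebra_simps)
  define y where "y = (1 - q) * a * e"
  have bq: "b * (1 - q) = b" using b by (simp add: algebra_simps)
  have by_e: "b * y = e" 
  proof -
    have "b * y = b * (1 - q) * a * ((1 - p) * e)" by (simp add: y_def pe mult.assoc)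
    also have "\<dots> = b * a * (1 - p) * e" by (simp add: bq mult.assoc)
    finally show ?thesis by (simp add: b pe)
  qed
  have qy: "q * y = 0" using q by (simp add: y_def right_diff_distrib is_projD left_diff_distrib flip: mult.assoc)
  have "y \<in> F" unfolding y_def by (intro ideal_mult_left[OF F] e)
  moreover have "y * e = y" by (simp add: y_def mult.assoc ee)
  moreover have "e * b * y = e" by (simp add: by_e ee mult.assoc)
  ultimately obtain f m where f: "is_proj f" "f \<in> F" "proj_equiv e f" "f * y = y" "f = y * m"
    using range_projection[OF F e(1,2)] by metis
  have qf: "q * f = 0" by (metis f(5) mult.assoc mult_zero_left qy)
  have fq: "f * q = 0" using arg_cong[OF qf, of star] f(1) q by (simp add: star_mult is_projD)
  have bf: "b * f = e * m" by (metis by_e f(5) mult.assoc)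
  have ff: "f * f = f" using f by (simp add: is_projD)
  define B where "B = (1 - e) * b * (1 - f)"
  have fy: "(1 - f) * (1 - q) * a * e = 0" using f(4) by (simp add: left_diff_distrib y_def mult.assoc)
  have split: "1 - (q + f) = (1 - f) * (1 - q)" "1 - (p + e) = (1 - e) * (1 - p)"
    using fq e by (simp_all add: algebra_simps)
  have Q: "is_proj (q + f)" and P: "is_proj (p + e)" using is_proj_add p q f e qf fq by blast+
  have "invertible_up_to a (p + e) (q + f)"
    unfolding invertible_up_to_iff[OF P Q]
  proof (intro exI[of _ B] conjI)
    have "(p + e) * (1 - e) = p" using ee e by (simp add: algebra_simps)
    then show "(p + e) * B = 0" unfolding B_def by (metis b(1) mult.assoc mult_zero_left)
    have "(1 - f) * (q + f) = q" using ff fq by (simp add: algebra_simps)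
    then show "B * (q + f) = 0" unfolding B_def by (metis b(2) mult.assoc mult_zero_right)
    have "(1 - (q + f)) * a * B = ((1 - f) * (1 - q) * a * (1 - e)) * b * (1 - f)"
      unfolding split B_def by (simp only: mult.assoc)
    also have "(1 - f) * (1 - q) * a * (1 - e) = (1 - f) * (1 - q) * a"
      using fy by (simp add: right_diff_distrib[of _ 1 e])
    also have "(1 - f) * (1 - q) * a * b * (1 - f) = (1 - f) * (1 - q) * (1 - f)"
      using b(3) by (simp only: mult.assoc)
    also have "\<dots> = 1 - (q + f)" using ff fq qf by (simp add: algebra_simps)
    finally show "(1 - (q + f)) * a * B = 1 - (q + f)" .
    have Pq: "1 - (p + e) = (1 - p) * (1 - e)" using e by (simp add: algebra_simps)
    \<comment> \<open>\<open>b\<close> maps the range of \<open>f\<close> into that of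
      \<open>e\<close>, so after the cut by \<open>1 - e\<close> the factor \<open>1 - f\<close> of
      \<open>B\<close> drops out.\<close>
    have "(1 - e) * b * f = 0" using bf ee by (simp add: mult.assoc) (simp add: left_diff_distrib flip: mult.assoc)
    then have "B = (1 - e) * b" by (simp add: B_def right_diff_distrib[of _ 1 f])
    then have "B * a * (1 - (p + e)) = (1 - e) * (b * a * (1 - p)) * (1 - e)"
      unfolding Pq by (simp only: mult.assoc)
    also have "\<dots> = 1 - (p + e)" unfolding b(4) using e ee by (simp add: algebra_simps)
    finally show "B * a * (1 - (p + e)) = 1 - (p + e)" .
  qed
  then show thesis using that f qf fq by blast
qed

subsection \<open>Split embeddings of right modules\<close>

text \<open>
  A right module is a pair (action, carrier). Over an idempotent \<open>p\<close> it is \<open>p\<A>\<close>;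
  \<open>emb False M N\<close> says that \<open>M\<close> is a retract of \<open>N\<close>, and \<open>emb True M N\<close> that they are isomorphic.
  The maps are not required to be additive.
\<close>

definition emb :: "bool \<Rightarrow> ('m \<Rightarrow> 'a \<Rightarrow> 'm) \<times> 'm set \<Rightarrow> ('n \<Rightarrow> 'a \<Rightarrow> 'n) \<times> 'n set \<Rightarrow> bool" where
  "emb i M N \<longleftrightarrow> (\<exists>f g.
     (\<forall>x\<in>snd M. f x \<in> snd N \<and> g (f x) = x \<and> (\<forall>a. f (fst M x a) = fst N (f x) a)) \<and>
     (\<forall>y\<in>snd N. g y \<in> snd M \<and> (i \<longrightarrow> f (g y) = y) \<and> (\<forall>a. g (fst N y a) = fst M (g y) a)))"

definition rmod :: "'a::semigroup_mult \<Rightarrow> ('a \<Rightarrow> 'a \<Rightarrow> 'a) \<times> 'a set" where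
  "rmod p = ((*), {x. p * x = x})"

definition dsum :: "('m \<Rightarrow> 'a \<Rightarrow> 'm) \<times> 'm set \<Rightarrow> ('n \<Rightarrow> 'a \<Rightarrow> 'n) \<times> 'n set \<Rightarrow>
    ('m \<times> 'n \<Rightarrow> 'a \<Rightarrow> 'm \<times> 'n) \<times> ('m \<times> 'n) set"  (infixr "\<oplus>" 65) where
  "M \<oplus> N = ((\<lambda>x a. (fst M (fst x) a, fst N (snd x) a)), snd M \<times> snd N)"

lemma embI:
  assumes "\<And>x. x \<in> snd M \<Longrightarrow> f x \<in> snd N" "\<And>x. x \<in> snd M \<Longrightarrow> g (f x) = x"
    "\<And>x a. x \<in> snd M \<Longrightarrow> f (fst M x a) = fst N (f x) a"
    "\<And>y. y \<in> snd N \<Longrightarrow> g y \<in> snd M" "\<And>y. y \<in> snd N \<Longrightarrow> i \<Longrightarrow> f (g y) = y"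
    "\<And>y a. y \<in> snd N \<Longrightarrow> g (fst N y a) = fst M (g y) a"
  shows "emb i M N"
  unfolding emb_def by (rule exI[of _ f], rule exI[of _ g]) (use assms in blast)

lemma emb_refl: "emb i M M"
  by (rule embI[where f = id and g = id]) auto

lemma emb_trans [trans]:
  assumes "emb i M N" "emb i N K"
  shows "emb i M K"
proof -
  obtain f g where fg: "\<forall>x\<in>snd M. f x \<in> snd N \<and> g (f x) = x \<and> (\<forall>a. f (fst M x a) = fst N (f x) a)"
    "\<forall>y\<in>snd N. g y \<in> snd M \<and> (i \<longrightarrow> f (g y) = y) \<and> (\<forall>a. g (fst N y a) = fst M (g y) a)"
    using assms(1) unfolding emb_def by blast
  obtain f' g' where fg': "\<forall>x\<in>snd N. f' x \<in> snd K \<and> g' (f' x) = x \<and> (\<forall>a. f' (fst N x a) = fst K (f' x) a)"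
    "\<forall>y\<in>snd K. g' y \<in> snd N \<and> (i \<longrightarrow> f' (g' y) = y) \<and> (\<forall>a. g' (fst K y a) = fst N (g' y) a)"
    using assms(2) unfolding emb_def by blast
  show ?thesis
    by (rule embI[where f = "f' \<circ> f" and g = "g \<circ> g'"]) (use fg fg' in auto)
qed

lemma emb_sym: "emb True M N \<Longrightarrow> emb i N M"
  unfolding emb_def by metis

lemma emb_dsum:
  assumes "emb i M N" "emb i M' N'"
  shows "emb i (M \<oplus> M') (N \<oplus> N')"
proof -
  obtain f g where fg: "\<forall>x\<in>snd M. f x \<in> snd N \<and> g (f x) = x \<and> (\<forall>a. f (fst M x a) = fst N (f x) a)"
    "\<forall>y\<in>snd N. g y \<in> snd M \<and> (i \<longrightarrow> f (g y) = y) \<and> (\<forall>a. g (fst N y a) = fst M (g y) a)"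
    using assms(1) unfolding emb_def by blast
  obtain f' g' where fg': "\<forall>x\<in>snd M'. f' x \<in> snd N' \<and> g' (f' x) = x \<and> (\<forall>a. f' (fst M' x a) = fst N' (f' x) a)"
    "\<forall>y\<in>snd N'. g' y \<in> snd M' \<and> (i \<longrightarrow> f' (g' y) = y) \<and> (\<forall>a. g' (fst N' y a) = fst M' (g' y) a)"
    using assms(2) unfolding emb_def by blast
  show ?thesis
    by (rule embI[where f = "map_prod f f'" and g = "map_prod g g'"])
      (use fg fg' in \<open>auto simp: dsum_def\<close>)
qed

lemma emb_dsum_swap: "emb i (M \<oplus> N) (N \<oplus> M)"
  by (rule embI[where f = prod.swap and g = prod.swap]) (auto simp: dsum_def)

lemma emb_dsum_assoc: "emb i ((M \<oplus> N) \<oplus> K) (M \<oplus> N \<oplus> K)"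
  by (rule embI[where f = "\<lambda>((x, y), z). (x, y, z)" and g = "\<lambda>(x, y, z). ((x, y), z)"])
    (auto simp: dsum_def)

lemma emb_rmod_add:
  fixes p e :: "'a::ring"
  assumes "p * p = p" "e * e = e" "p * e = 0" "e * p = 0"
  shows "emb i (rmod (p + e)) (rmod p \<oplus> rmod e)"
proof (rule embI[where f = "\<lambda>x. (p * x, e * x)" and g = "\<lambda>(x, y). x + y"])
  have *: "p * (p * x) = p * x" "e * (e * x) = e * x" "p * (e * x) = 0" "e * (p * x) = 0" for x
    using assms by (simp_all flip: mult.assoc)
  have **: "p * y = 0" "e * x = 0" if "p * x = x" "e * y = y" for x y
    using *(3)[of y] *(4)[of x] that by simp_all
  show "x \<in> snd (rmod (p + e)) \<Longrightarrow> (p * x, e * x) \<in> snd (rmod p \<oplus> rmod e)" for x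
    by (auto simp: dsum_def rmod_def *)
  show "x \<in> snd (rmod (p + e)) \<Longrightarrow> (case (p * x, e * x) of (x, y) \<Rightarrow> x + y) = x" for x
    by (simp add: rmod_def distrib_right)
  fix w assume w: "w \<in> snd (rmod p \<oplus> rmod e)"
  obtain x y where xy: "w = (x, y)" "p * x = x" "e * y = y"
    using w by (cases w) (auto simp: rmod_def dsum_def)
  show "(case w of (x, y) \<Rightarrow> x + y) \<in> snd (rmod (p + e))"
    using **[OF xy(2,3)] by (simp add: xy rmod_def distrib_right distrib_left)
  show "(p * (case w of (x, y) \<Rightarrow> x + y), e * (case w of (x, y) \<Rightarrow> x + y)) = w"
    using **[OF xy(2,3)] by (simp add: xy distrib_left)
qed (auto simp: rmod_def dsum_def mult.assoc distrib_right)

text \<open>\<open>E * x\<close> and \<open>E' * x\<close> determine each other, so multiplication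
  by one idempotent undoes multiplication by the other. In a ring the equations say that
  \<open>1 - E\<close> and \<open>1 - E'\<close> have the same range.\<close>

lemma emb_rmod_same_range:
  fixes E E' :: "'a::semigroup_mult"
  assumes "E * E' = E" "E' * E = E'"
  shows "emb i (rmod E) (rmod E')"
proof -
  have "E' * (E' * x) = E' * x" "E * (E * x) = E * x" "E * (E' * x) = E * x" "E' * (E * x) = E' * x" for x
    using assms by (metis mult.assoc)+
  then show ?thesis
    by (intro embI[where f = "\<lambda>x. E' * x" and g = "\<lambda>x. E * x"]) (auto simp: rmod_def mult.assoc)
qed

lemma emb_if_proj_equiv:
  assumes p: "is_proj p" and "proj_equiv p q"
  shows "emb i (rmod p) (rmod q)"
proof -
  obtain v where v: "v * star v = p" "star v * v = q" using assms by (auto simp: proj_equiv_def)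
  have vv: "v * (star v * x) = p * x" "star v * (v * x) = q * x" for x by (simp_all add: v flip: mult.assoc)
  have "p * v = v" using partial_isometry(1)[of v] p v by simp
  then have 1: "p * (v * x) = v * x" for x by (simp flip: mult.assoc)
  have "q * star v = star v * p" by (simp add: mult.assoc flip: v)
  then have 2: "q * (star v * x) = star v * (p * x)" for x by (metis mult.assoc)
  show ?thesis
    by (rule embI[where f = "\<lambda>x. star v * x" and g = "\<lambda>x. v * x"])
      (auto simp: rmod_def mult.assoc vv 1 2)
qed

lemma emb_if_proj_subequiv:
  assumes p: "is_proj p" and "proj_subequiv p q"
  shows "emb False (rmod p) (rmod q)"
proof -
  obtain p' where p': "proj_le p' q" "proj_equiv p p'" "is_proj p'" using assms by (auto simp: proj_subequiv_def)
  have "emb False (rmod p') (rmod q)"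
  proof (rule embI[where f = id and g = "\<lambda>x. p' * x"])
    have *: "p' * (q * x) = p' * x" "q * (p' * x) = p' * x" for x
      using p' by (simp_all add: proj_le_def flip: mult.assoc)
    show "x \<in> snd (rmod p') \<Longrightarrow> id x \<in> snd (rmod q)" for x
      using *(2)[of x] by (simp add: rmod_def)
    have "p' * p' = p'" using p'(3) by (rule is_projD)
    then show "y \<in> snd (rmod q) \<Longrightarrow> p' * y \<in> snd (rmod p')" for y
      by (simp add: rmod_def flip: mult.assoc)
  qed (auto simp: rmod_def mult.assoc)
  then show ?thesis using emb_if_proj_equiv[OF p p'(2)] emb_trans by blast
qed

text \<open>Equivariance makes \<open>f\<close> and \<open>g\<close> left multiplications by
  \<open>x = f p\<close> and \<open>z = g q\<close>. The range projection of \<open>x\<close> then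
  replaces this algebraic relation by one through a partial isometry.\<close>

lemma emb_imp_proj_subequiv:
  assumes F: "finite_type_ideal TYPE('i) F" and p: "p \<in> F" "is_proj p" and q: "is_proj q"
    and emb: "emb i (rmod p) (rmod q)"
  shows "proj_subequiv p q" "i \<Longrightarrow> proj_equiv p q"
proof -
  obtain f g where f: "\<And>x. p * x = x \<Longrightarrow> q * f x = f x \<and> g (f x) = x \<and> (\<forall>a. f (x * a) = f x * a)"
    and g: "\<And>y. q * y = y \<Longrightarrow> p * g y = g y \<and> (i \<longrightarrow> f (g y) = y) \<and> (\<forall>a. g (y * a) = g y * a)"
    using emb unfolding emb_def rmod_def by auto
  have pp: "p * p = p" and qq: "q * q = q" using p q by (simp_all add: is_projD)
  define x z where "x = f p" and "z = g q"
  have qx: "q * x = x" and xp: "x * p = x" using f[OF pp] pp unfolding x_def by metis+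
  have zx: "z * x = p" using f[OF pp] g[OF qq] unfolding x_def z_def by metis
  have "x \<in> F" using ideal_mult_left[OF F p(1), of x] xp by simp
  from range_projection[OF F p this xp zx]
  obtain r m where r: "is_proj r" "proj_equiv p r" "r * x = x" "r = x * m" by blast
  have qr: "q * r = r" by (metis mult.assoc qx r(4))
  have rq: "r * q = r" using arg_cong[OF qr, of star] r(1) q by (simp add: star_mult is_projD)
  show "proj_subequiv p q"
    unfolding proj_subequiv_def proj_le_def using r qr rq by blast
  assume i
  \<comment> \<open>In the isomorphic case \<open>q\<close> is a right multiple of \<open>x\<close>,
    so the range projection of \<open>x\<close> is all of \<open>q\<close>.\<close>
  then have "x * z = q" using f[OF pp] g[OF qq] unfolding x_def z_def by metis
  then have "q = r" by (metis mult.assoc r(3) rq)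
  then show "proj_equiv p q" using r by simp
qed

subsection \<open>Comparing two pairs for the same element\<close>

text \<open>\<open>b * c\<close> differs from 1 by \<open>(1 - b * c) * p\<close>, which becomes
  small after right multiplication by \<open>1 - P\<close>. So the compression of
  \<open>b * c\<close> to the corner of \<open>1 - P\<close> is invertible.\<close>

lemma left_inverse_on_complement:
  assumes p: "is_proj p" and P: "is_proj P" and bc: "b * c * (1 - p) = 1 - p"
    and small: "norm (1 - b * c) * norm (p * P - p) < 1"
  obtains l where "P * l = 0" "l * c * (1 - P) = 1 - P"
proof -
  define K where "K = 1 - P"
  have K: "is_proj K" "K * K = K" using is_proj_compl[OF P] is_projD unfolding K_def by blast+
  define w where "w = K * ((1 - b * c) * (p * K))"
  have pK: "p * K = - (p * P - p)" by (simp add: K_def right_diff_distrib)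
  have "norm (p * K) = norm (p * P - p)" unfolding pK by (rule norm_minus_cancel)
  then have "norm w \<le> 1 * (norm (1 - b * c) * norm (p * P - p))"
    unfolding w_def by (intro norm_mult_le norm_proj_le K) auto
  then have "norm w \<le> norm (1 - b * c) * norm (p * P - p)" by simp
  moreover have "K * w = w" "w * K = w" unfolding w_def using K(2) by (metis mult.assoc)+
  ultimately obtain n where n: "K * n = n" "n * K = n" "n * (K - w) = K"
    using corner_neumann[OF K(1)] small by metis
  have "b * c = 1 - (1 - b * c) * p" using bc by (simp add: algebra_simps)
  then have "K * (b * c) * K = K * (1 - (1 - b * c) * p) * K" by simp
  also have "\<dots> = K * K - w" by (simp add: w_def algebra_simps)
  finally have KbcK: "K * (b * c) * K = K - w" by (simp add: K)
  show thesis
  proof (rule that[of "n * K * b"])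
    have "P * K = 0" using P by (simp add: K_def algebra_simps is_projD)
    then have "P * n = 0" by (metis mult.assoc mult_zero_left n(1))
    then show "P * (n * K * b) = 0" by (simp flip: mult.assoc)
    have "n * K * b * c * K = n * (K * (b * c) * K)" by (simp only: mult.assoc)
    then show "n * K * b * c * (1 - P) = 1 - P" using n(3) by (simp only: KbcK flip: K_def)
  qed
qed

text \<open>
  The element \<open>c\<close>, bordered by \<open>q\<close> and \<open>p\<close>, is an isomorphism \<open>\<A> \<oplus> q\<A> \<cong> \<A> \<oplus> p\<A>\<close>;
  splitting off \<open>(1 - P)\<A>\<close> and its image \<open>c (1 - P)\<A>\<close> leaves the following one.
\<close>

lemma emb_complement:
  fixes c :: "'a::unital_cstar_algebra"
  assumes p: "is_proj p" and q: "is_proj q" and P: "is_proj P"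
    and b: "p * b = 0" "b * q = 0" "(1 - q) * c * b = 1 - q" "b * c * (1 - p) = 1 - p"
    and l: "P * l = 0" "l * c * (1 - P) = 1 - P"
  shows "emb i (rmod P \<oplus> rmod q) (rmod (1 - c * l) \<oplus> rmod p)"
proof -
  define E where "E = 1 - c * l"
  \<comment> \<open>The bordered map is \<open>(x, y) \<mapsto> (c * x + y, p * x)\<close>. Before
    applying it, \<open>x\<close> is changed by \<open>l * (c * x + y)\<close>, an element of
    \<open>(1 - P)\<A>\<close>, which brings the first component into \<open>E\<A>\<close>.\<close>
  define f where "f = (\<lambda>(x, y). (E * (c * x + y), p * x - p * (l * (c * x + y))))"
  \<comment> \<open>First component of the inverse of the bordered map; \<open>g\<close> is this
    inverse followed by projecting that component with \<open>P\<close>.\<close>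
  define s where "s = (\<lambda>(\<xi>, \<eta>). b * \<xi> + \<eta> - b * (c * \<eta>))"
  define g where "g = (\<lambda>w. (P * s w, q * fst w - q * (c * s w)))"
  have lcP: "l * (c * x) = x - P * x + l * (c * (P * x))" for x
  proof -
    have "l * (c * x) = l * c * (1 - P) * x + l * (c * (P * x))" by (simp add: algebra_simps)
    then show ?thesis by (simp add: l left_diff_distrib)
  qed
  have Pl: "P * (l * x) = 0" for x by (simp add: l flip: mult.assoc)
  have lcl: "l * (c * (l * x)) = l * x" for x using lcP[of "l * x"] by (simp add: Pl)
  have EE: "E * (E * x) = E * x" for x by (simp add: E_def algebra_simps lcl)
  have lE: "l * (E * x) = 0" for x by (simp add: E_def algebra_simps lcl)
  have pb: "p * (b * x) = 0" and bq: "b * (q * x) = 0" for x by (simp_all add: b flip: mult.assoc)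
  have bcp: "b * (c * x) = x - p * x + b * (c * (p * x))" for x
  proof -
    have "b * (c * x) = b * c * (1 - p) * x + b * (c * (p * x))" by (simp add: algebra_simps)
    then show ?thesis by (simp add: b left_diff_distrib)
  qed
  have cb: "c * (b * x) - q * (c * (b * x)) = x - q * x" for x
  proof -
    have "c * (b * x) - q * (c * (b * x)) = (1 - q) * c * b * x" by (simp add: algebra_simps)
    then show ?thesis unfolding b(3) by (simp add: left_diff_distrib)
  qed
  have idem: "p * (p * x) = p * x" "q * (q * x) = q * x" "P * (P * x) = P * x" for x
    using p q P by (simp_all add: is_projD)
  have gf: "g (f (x, y)) = (x, y)" if "P * x = x" "q * y = y" for x y
  proof -
    define t where "t = x - l * (c * x + y)"
    have f: "f (x, y) = (c * t + y, p * t)"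
      by (simp add: f_def E_def t_def algebra_simps)
    have "b * y = 0" using bq[of y] that by simp
    then have "s (f (x, y)) = t" unfolding f using bcp[of t] by (simp add: s_def distrib_left)
    moreover have "P * t = x" by (simp add: t_def right_diff_distrib Pl that)
    ultimately show ?thesis unfolding g_def by (simp add: f distrib_left that)
  qed
  have fg: "f (g (\<xi>, \<eta>)) = (\<xi>, \<eta>)" if "E * \<xi> = \<xi>" "p * \<eta> = \<eta>" for \<xi> \<eta>
  proof -
    define t where "t = s (\<xi>, \<eta>)"
    have t: "t = b * \<xi> + \<eta> - b * (c * \<eta>)" by (simp add: t_def s_def)
    have l\<xi>: "l * \<xi> = 0" using lE[of \<xi>] that by simp
    have "c * t - q * (c * t) = (c * (b * \<xi>) - q * (c * (b * \<xi>))) + (c * \<eta> - q * (c * \<eta>))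
        - (c * (b * (c * \<eta>)) - q * (c * (b * (c * \<eta>))))"
      by (simp add: t algebra_simps)
    then have ct: "c * t - q * (c * t) = \<xi> - q * \<xi>" by (simp add: cb)
    then have "q * \<xi> - q * (c * t) = \<xi> - c * t" by (simp add: algebra_simps)
    then have g: "g (\<xi>, \<eta>) = (P * t, \<xi> - c * t)" by (simp add: g_def t_def)
    have pt: "p * t = \<eta>" by (simp add: t algebra_simps pb that)
    have lu: "l * (c * (P * t) + (\<xi> - c * t)) = P * t - t"
      using lcP[of t] l\<xi> by (simp add: algebra_simps)
    have "E * (c * (P * t) + (\<xi> - c * t)) = c * (P * t) + (\<xi> - c * t) - c * (P * t - t)"
      unfolding E_def by (simp only: left_diff_distrib mult_1_left mult.assoc lu)
    also have "\<dots> = \<xi>" by (simp add: algebra_simps)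
    finally show ?thesis unfolding g by (simp add: f_def lu pt right_diff_distrib)
  qed
  have "emb i (rmod P \<oplus> rmod q) (rmod E \<oplus> rmod p)"
  proof (rule embI[where f = f and g = g])
    show "w \<in> snd (rmod P \<oplus> rmod q) \<Longrightarrow> g (f w) = w" for w
      by (auto simp: dsum_def rmod_def gf)
    show "w \<in> snd (rmod E \<oplus> rmod p) \<Longrightarrow> f (g w) = w" for w
      by (auto simp: dsum_def rmod_def fg)
    show "w \<in> snd (rmod P \<oplus> rmod q) \<Longrightarrow> f w \<in> snd (rmod E \<oplus> rmod p)" for w
      by (auto simp: dsum_def rmod_def f_def EE idem right_diff_distrib)
    show "w \<in> snd (rmod E \<oplus> rmod p) \<Longrightarrow> g w \<in> snd (rmod P \<oplus> rmod q)" for w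
      by (auto simp: dsum_def rmod_def g_def idem right_diff_distrib)
  qed (auto simp: dsum_def rmod_def f_def g_def s_def algebra_simps)
  then show ?thesis by (simp add: E_def)
qed

text \<open>Instead of cancelling \<open>P\<close> and \<open>p'\<close> when the two pairs of
  \<open>c\<close> are compared, a copy \<open>e\<close> of their sum is added on both sides by
  enlarging \<open>(p, q)\<close>. The value \<open>i = False\<close> serves the semi-Weyl sets,
  \<open>i = True\<close> the Weyl set.\<close>

lemma invertible_up_to_transfer:
  assumes F: "finite_type_ideal TYPE('i) F"
    and p: "p \<in> F" "is_proj p" and q: "is_proj q" and p': "p' \<in> F" "is_proj p'" and q': "is_proj q'"
    and a: "invertible_up_to a p q" and c: "invertible_up_to c p q" and c': "invertible_up_to c p' q'"
    and emb: "emb i (rmod p') (rmod q')"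
  obtains P Q where "is_proj P" "is_proj Q" "invertible_up_to a P Q" "P \<in> F" "q \<in> F \<Longrightarrow> Q \<in> F"
    "emb i (rmod P) (rmod Q)"
proof -
  obtain b where b: "p * b = 0" "b * q = 0" "(1 - q) * c * b = 1 - q" "b * c * (1 - p) = 1 - p"
    using c invertible_up_to_iff[OF p(2) q] by blast
  obtain b' where b': "p' * b' = 0" "b' * q' = 0" "(1 - q') * c * b' = 1 - q'" "b' * c * (1 - p') = 1 - p'"
    using c' invertible_up_to_iff[OF p'(2) q'] by blast
  \<comment> \<open>It dominates both defects, so one \<open>P\<close> meets the smallness condition
    for either pair.\<close>
  define \<beta> where "\<beta> = 1 + norm (1 - b * c) + norm (1 - b' * c)"
  have \<beta>: "0 < \<beta>" unfolding \<beta>_def by (simp add: add_pos_nonneg)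
  obtain P where P: "P \<in> F" "is_proj P" "norm (p * P - p) < 1 / \<beta>" "norm (p' * P - p') < 1 / \<beta>"
    using ideal_approx_proj[OF F p(1) p'(1), of "1 / \<beta>"] \<beta> by auto
  have small: "x * y < 1" if "0 \<le> x" "x \<le> \<beta>" "0 \<le> y" "y < 1 / \<beta>" for x y :: real
  proof -
    have "x * y \<le> \<beta> * y" using that by (intro mult_right_mono) auto
    also have "\<dots> < 1" using that \<beta> by (simp add: field_simps)
    finally show ?thesis .
  qed
  obtain l where l: "P * l = 0" "l * c * (1 - P) = 1 - P"
    using left_inverse_on_complement[OF p(2) P(2) b(4)] small P(3) \<beta>_def by (metis add_increasing add_increasing2 le_add_same_cancel1 norm_ge_zero order_refl zero_le_one)
  obtain l' where l': "P * l' = 0" "l' * c * (1 - P) = 1 - P"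
    using left_inverse_on_complement[OF p'(2) P(2) b'(4)] small P(4) \<beta>_def by (metis add_increasing add_increasing2 le_add_same_cancel1 norm_ge_zero order_refl zero_le_one)
  \<comment> \<open>\<open>y\<close> has range in \<open>(1 - P)\<A>\<close>, where
    \<open>x * c\<close> is the identity. Thus \<open>c * l\<close> and \<open>c * l'\<close> are
    idempotents with the same range \<open>c (1 - P)\<A>\<close>.\<close>
  have Eq: "(1 - c * x) * (1 - c * y) = 1 - c * x" if "P * y = 0" "x * c * (1 - P) = 1 - P" for x y
  proof -
    have "y = (1 - P) * y" using that by (simp add: algebra_simps)
    then have "x * c * y = (1 - P) * y" using that(2) by (metis mult.assoc)
    then have "x * (c * y) = y" using \<open>y = (1 - P) * y\<close> by (simp add: mult.assoc)
    then show ?thesis by (simp add: algebra_simps)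
  qed
  let ?E = "1 - c * l" and ?E' = "1 - c * l'"
  have EE': "emb i (rmod ?E') (rmod ?E)"
    by (rule emb_rmod_same_range) (intro Eq l l')+
  have 1: "emb i (rmod ?E \<oplus> rmod p) (rmod P \<oplus> rmod q)"
    by (rule emb_sym, rule emb_complement[OF p(2) q P(2) b l])
  have 2: "emb i (rmod P \<oplus> rmod q') (rmod ?E' \<oplus> rmod p')"
    by (rule emb_complement[OF p'(2) q' P(2) b' l'])
  \<comment> \<open>A copy of \<open>p'\<close> orthogonal to \<open>P\<close> turns
    \<open>P \<oplus> p'\<close> into one projection \<open>e1\<close>; a copy of \<open>e1\<close>
    orthogonal to \<open>p\<close> is then the required \<open>e\<close>.\<close>
  obtain v where v: "v * star v = p'" "is_proj (star v * v)" "star v * v \<in> F"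
      "star v * v * P = 0" "P * (star v * v) = 0"
    using ideal_orthogonal_copy[OF F P(1,2) p'] by metis
  define e1 where "e1 = P + star v * v"
  have e1: "is_proj e1" "e1 \<in> F"
    unfolding e1_def using is_proj_add[OF P(2) v(2) v(5,4)] ideal_add[OF F P(1) v(3)] by auto
  obtain u where u: "u * star u = e1" "is_proj (star u * u)" "star u * u \<in> F"
      "star u * u * p = 0" "p * (star u * u) = 0"
    using ideal_orthogonal_copy[OF F p e1(2,1)] by metis
  define e where "e = star u * u"
  note e = u(2-5)[folded e_def]
  have eqv: "emb True (rmod e) (rmod P \<oplus> rmod p')"
  proof -
    have "proj_equiv e1 e" using u(1) by (auto simp: proj_equiv_def e_def)
    then have "emb True (rmod e) (rmod e1)" using emb_if_proj_equiv[OF e1(1)] emb_sym by blast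
    also have "emb True (rmod e1) (rmod P \<oplus> rmod (star v * v))"
      unfolding e1_def using P v by (intro emb_rmod_add) (simp_all add: is_projD)
    also have "emb True (rmod P \<oplus> rmod (star v * v)) (rmod P \<oplus> rmod p')"
    proof (intro emb_dsum emb_refl)
      have "proj_equiv p' (star v * v)" using v(1) by (auto simp: proj_equiv_def)
      then show "emb True (rmod (star v * v)) (rmod p')"
        using emb_if_proj_equiv[OF p'(2)] emb_sym by blast
    qed
    finally show ?thesis .
  qed
  obtain f where f: "is_proj f" "f \<in> F" "proj_equiv e f" "q * f = 0" "f * q = 0"
      "invertible_up_to a (p + e) (q + f)"
    using invertible_up_to_extend[OF F p(2) q a e(2,1,4,3)] by metis
  \<comment> \<open>Apart from replacing \<open>p'\<close> by \<open>q'\<close>, all links are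
    isomorphisms. \<open>P \<oplus> q'\<close> becomes \<open>E \<oplus> p'\<close>, then
    \<open>E\<close> and the waiting \<open>p\<close> become \<open>P \<oplus> q\<close>, and
    \<open>P \<oplus> p'\<close> is again \<open>e\<close>.\<close>
  have "emb i (rmod (p + e)) (rmod p \<oplus> rmod e)"
    using p(2) e by (intro emb_rmod_add) (simp_all add: is_projD)
  \<comment> \<open>Reversing twice weakens \<open>emb True\<close> to \<open>emb i\<close>.\<close>
  also have "emb i (rmod p \<oplus> rmod e) (rmod p \<oplus> (rmod P \<oplus> rmod p'))"
    by (intro emb_dsum emb_refl emb_sym[OF emb_sym[OF eqv]])
  also have "emb i (rmod p \<oplus> (rmod P \<oplus> rmod p')) (rmod p \<oplus> (rmod P \<oplus> rmod q'))"
    by (intro emb_dsum emb_refl emb)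
  also have "emb i (rmod p \<oplus> (rmod P \<oplus> rmod q')) (rmod p \<oplus> (rmod ?E' \<oplus> rmod p'))"
    by (intro emb_dsum emb_refl 2)
  also have "emb i (rmod p \<oplus> (rmod ?E' \<oplus> rmod p')) (rmod p \<oplus> (rmod ?E \<oplus> rmod p'))"
    by (intro emb_dsum emb_refl EE')
  also have "emb i (rmod p \<oplus> (rmod ?E \<oplus> rmod p')) ((rmod p \<oplus> rmod ?E) \<oplus> rmod p')"
    by (rule emb_sym[OF emb_dsum_assoc])
  also have "emb i ((rmod p \<oplus> rmod ?E) \<oplus> rmod p') ((rmod ?E \<oplus> rmod p) \<oplus> rmod p')"
    by (intro emb_dsum emb_refl emb_dsum_swap)
  also have "emb i ((rmod ?E \<oplus> rmod p) \<oplus> rmod p') ((rmod P \<oplus> rmod q) \<oplus> rmod p')"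
    by (intro emb_dsum emb_refl 1)
  also have "emb i ((rmod P \<oplus> rmod q) \<oplus> rmod p') ((rmod q \<oplus> rmod P) \<oplus> rmod p')"
    by (intro emb_dsum emb_refl emb_dsum_swap)
  also have "emb i ((rmod q \<oplus> rmod P) \<oplus> rmod p') (rmod q \<oplus> (rmod P \<oplus> rmod p'))"
    by (rule emb_dsum_assoc)
  also have "emb i (rmod q \<oplus> (rmod P \<oplus> rmod p')) (rmod q \<oplus> rmod e)"
    by (intro emb_dsum emb_refl emb_sym[OF eqv])
  also have "emb i (rmod q \<oplus> rmod e) (rmod q \<oplus> rmod f)"
    by (intro emb_dsum emb_refl emb_if_proj_equiv e f)
  also have "emb i (rmod q \<oplus> rmod f) (rmod (q + f))"
    using q f by (intro emb_sym[OF emb_rmod_add]) (simp_all add: is_projD)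
  finally have "emb i (rmod (p + e)) (rmod (q + f))" .
  moreover have "is_proj (p + e)" "is_proj (q + f)" using is_proj_add p(2) q e f by blast+
  moreover have "p + e \<in> F" "q \<in> F \<Longrightarrow> q + f \<in> F" using ideal_add[OF F] p(1) e(2) f(2) by auto
  ultimately show thesis using that f(6) by blast
qed

subsection \<open>Boundaries\<close>

lemma lower_ideal_if_Fredholm:
  assumes F: "finite_type_ideal TYPE('i) F" and p: "p \<in> F" "is_proj p" and q: "is_proj q"
    and c: "invertible_up_to c p q" "c \<in> KPhi F"
  shows "q \<in> F"
proof -
  obtain b where b: "p * b = 0" "b * q = 0" "b * c * (1 - p) = 1 - p"
    using c(1) invertible_up_to_iff[OF p(2) q] by blast
  obtain p' q' where p': "p' \<in> F" "is_proj p'" and q': "q' \<in> F" "is_proj q'"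
      and c': "invertible_up_to c p' q'"
    using c(2) by (auto simp: KPhi_def)
  obtain b' where b': "(1 - q') * c * b' = 1 - q'" using c' invertible_up_to_iff[OF p'(2) q'(2)] by blast
  note I = ideal_mult_left[OF F] ideal_mult_right[OF F] ideal_diff[OF F] ideal_add[OF F]
  \<comment> \<open>Modulo \<open>F\<close>, \<open>b\<close> is a left inverse of \<open>c\<close> and \<open>b'\<close> is a right inverse, so \<open>c b \<equiv> 1\<close>; but \<open>b q = 0\<close>.\<close>
  have "1 - b * c = (1 - b * c) * p" using b(3) by (simp add: algebra_simps)
  then have bc: "1 - b * c \<in> F" using I(1)[OF p(1), of "1 - b * c"] by simp
  have "1 - c * b' = q' * (1 - c * b')" using b' by (simp add: algebra_simps)
  then have cb': "1 - c * b' \<in> F" using I(2)[OF q'(1), of "1 - c * b'"] by simp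
  have "(1 - c * b) * q = q" using b(2) by (simp add: algebra_simps mult.assoc)
  moreover have "1 - c * b = (1 - c * b) * (1 - c * b') + c * (1 - b * c) * b'" by (simp add: algebra_simps)
  then have "1 - c * b \<in> F" using I(4)[OF I(1)[OF cb', of "1 - c * b"] I(2)[OF I(1)[OF bc, of c], of b']] by simp
  ultimately show ?thesis using I(2)[of "1 - c * b" q] by simp
qed

lemma frontier_obtain:
  assumes "open S" "a \<in> frontier S" and p: "is_proj p" and q: "is_proj q" and a: "invertible_up_to a p q"
  obtains c where "a \<notin> S" "c \<in> S" "invertible_up_to c p q"
proof -
  have "a \<in> closure S" "a \<notin> S" using assms(1,2) by (auto simp: frontier_def interior_open)
  then have "S \<inter> {a. invertible_up_to a p q} \<noteq> {}"
    using open_invertible_up_to[OF p q] a by (auto simp: closure_iff_nhds_not_empty)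
  then show thesis using that \<open>a \<notin> S\<close> by blast
qed

lemma open_invertible_up_to_Collect:
  "open {a. \<exists>p q. is_proj p \<and> is_proj q \<and> invertible_up_to a p q \<and> R p q}"
proof -
  have "{a. \<exists>p q. is_proj p \<and> is_proj q \<and> invertible_up_to a p q \<and> R p q} =
      (\<Union>(p, q)\<in>{(p, q). is_proj p \<and> is_proj q \<and> R p q}. {a. invertible_up_to a p q})"
    by auto
  also have "open \<dots>" by (rule open_UN) (auto intro: open_invertible_up_to)
  finally show ?thesis .
qed

lemma open_KPhi: "open (KPhi F)"
  and open_KPhi_plus_minus: "open (KPhi_plus_minus F)"
  and open_KPhi_minus_plus: "open (KPhi_minus_plus F)"
  and open_KPhi_zero: "open (KPhi_zero F)"
  unfolding KPhi_def KPhi_plus_minus_def KPhi_minus_plus_def KPhi_zero_def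
  by (rule open_invertible_up_to_Collect)+

lemma KPhi_star: "a \<in> KPhi F \<Longrightarrow> star a \<in> KPhi F"
  unfolding KPhi_def using invertible_up_to_star by blast

theorem corollary3p18:
  fixes F :: "'a::unital_cstar_algebra set" and a :: 'a
  assumes "finite_type_ideal TYPE('i) F"
  shows "(a \<in> frontier (KPhi F) \<longrightarrow> a \<in> UNIV - (KPhi_plus F \<union> KPhi_minus F)) \<and>
         (a \<in> frontier (KPhi_plus_minus F) \<longrightarrow> a \<in> UNIV - KPhi_plus F) \<and>
         (a \<in> frontier (KPhi_minus_plus F) \<longrightarrow> a \<in> UNIV - KPhi_minus F) \<and>
         (a \<in> frontier (KPhi_zero F) \<longrightarrow> a \<in> UNIV - KPhi F)"
proof -
  note F = assms
  \<comment> \<open>Every case ends in the same contradiction: the set is open and so misses its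
    boundary point \<open>a\<close>, yet \<open>a\<close> turns out to belong to it.\<close>
  have "a \<notin> KPhi_plus F" if fr: "a \<in> frontier (KPhi F)"
  proof
    assume "a \<in> KPhi_plus F"
    then obtain p q where p: "p \<in> F" "is_proj p" and q: "is_proj q" and a: "invertible_up_to a p q"
      by (auto simp: KPhi_plus_def)
    obtain c where c: "a \<notin> KPhi F" "c \<in> KPhi F" "invertible_up_to c p q"
      using frontier_obtain[OF _ fr p(2) q a] open_KPhi by blast
    have "q \<in> F" using lower_ideal_if_Fredholm[OF F p q c(3,2)] .
    then show False using c(1) p q a by (auto simp: KPhi_def)
  qed
  moreover have "a \<notin> KPhi_minus F" if fr: "a \<in> frontier (KPhi F)"
  proof
    assume "a \<in> KPhi_minus F"
    then obtain p q where p: "is_proj p" and q: "q \<in> F" "is_proj q" and a: "invertible_up_to a p q"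
      by (auto simp: KPhi_minus_def)
    obtain c where c: "a \<notin> KPhi F" "c \<in> KPhi F" "invertible_up_to c p q"
      using frontier_obtain[OF _ fr p q(2) a] open_KPhi by blast
    \<comment> \<open>For \<open>star c\<close> the pair is \<open>(q, p)\<close>, so
      \<open>p\<close> is now the projection whose membership is deduced.\<close>
    have "p \<in> F"
      using lower_ideal_if_Fredholm[OF F q p] invertible_up_to_star[OF p q(2) c(3)] KPhi_star[OF c(2)] by blast
    then show False using c(1) p q a by (auto simp: KPhi_def)
  qed
  moreover have "a \<notin> KPhi_plus F" if fr: "a \<in> frontier (KPhi_plus_minus F)"
  proof
    assume "a \<in> KPhi_plus F"
    then obtain p q where p: "p \<in> F" "is_proj p" and q: "is_proj q" and a: "invertible_up_to a p q"
      by (auto simp: KPhi_plus_def)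
    obtain c where c: "a \<notin> KPhi_plus_minus F" "c \<in> KPhi_plus_minus F" "invertible_up_to c p q"
      using frontier_obtain[OF _ fr p(2) q a] open_KPhi_plus_minus by blast
    obtain p' q' where p': "p' \<in> F" "is_proj p'" and q': "is_proj q'" and c': "invertible_up_to c p' q'"
      and s: "proj_subequiv p' q'" using c(2) by (auto simp: KPhi_plus_minus_def)
    obtain P Q where "is_proj P" "is_proj Q" "invertible_up_to a P Q" "P \<in> F" "emb False (rmod P) (rmod Q)"
      using invertible_up_to_transfer[OF F p q p' q' a c(3) c' emb_if_proj_subequiv[OF p'(2) s]] by blast
    then have "a \<in> KPhi_plus_minus F"
      using emb_imp_proj_subequiv(1)[OF F] unfolding KPhi_plus_minus_def by blast
    then show False using c(1) by blast
  qed
  moreover have "a \<notin> KPhi_minus F" if fr: "a \<in> frontier (KPhi_minus_plus F)"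
  proof
    assume "a \<in> KPhi_minus F"
    then obtain p q where p: "is_proj p" and q: "q \<in> F" "is_proj q" and a: "invertible_up_to a p q"
      by (auto simp: KPhi_minus_def)
    obtain c where c: "a \<notin> KPhi_minus_plus F" "c \<in> KPhi_minus_plus F" "invertible_up_to c p q"
      using frontier_obtain[OF _ fr p q(2) a] open_KPhi_minus_plus by blast
    obtain p' q' where p': "is_proj p'" and q': "q' \<in> F" "is_proj q'" and c': "invertible_up_to c p' q'"
      and s: "proj_subequiv q' p'" using c(2) by (auto simp: KPhi_minus_plus_def)
    \<comment> \<open>The transfer is applied to the adjoints, with the pairs \<open>(q, p)\<close>
      and \<open>(q', p')\<close>, and its result is read back through \<open>star\<close>.\<close>
    obtain Q P where "is_proj Q" "is_proj P" "invertible_up_to (star a) Q P" "Q \<in> F" "emb False (rmod Q) (rmod P)"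
      using invertible_up_to_transfer[OF F q p q' p' invertible_up_to_star[OF p q(2) a]
          invertible_up_to_star[OF p q(2) c(3)] invertible_up_to_star[OF p' q'(2) c']
          emb_if_proj_subequiv[OF q'(2) s]] by blast
    then have "a \<in> KPhi_minus_plus F"
      using emb_imp_proj_subequiv(1)[OF F] invertible_up_to_star[of Q P "star a"]
      unfolding KPhi_minus_plus_def star_star by blast
    then show False using c(1) by blast
  qed
  moreover have "a \<notin> KPhi F" if fr: "a \<in> frontier (KPhi_zero F)"
  proof
    assume "a \<in> KPhi F"
    then obtain p q where p: "p \<in> F" "is_proj p" and q: "q \<in> F" "is_proj q" and a: "invertible_up_to a p q"
      by (auto simp: KPhi_def)
    obtain c where c: "a \<notin> KPhi_zero F" "c \<in> KPhi_zero F" "invertible_up_to c p q"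
      using frontier_obtain[OF _ fr p(2) q(2) a] open_KPhi_zero by blast
    obtain p' q' where p': "p' \<in> F" "is_proj p'" and q': "is_proj q'" and c': "invertible_up_to c p' q'"
      and s: "proj_equiv p' q'" using c(2) by (auto simp: KPhi_zero_def)
    obtain P Q where "is_proj P" "is_proj Q" "invertible_up_to a P Q" "P \<in> F" "Q \<in> F" "emb True (rmod P) (rmod Q)"
      using invertible_up_to_transfer[OF F p q(2) p' q' a c(3) c' emb_if_proj_equiv[OF p'(2) s]] q(1) by blast
    then have "a \<in> KPhi_zero F"
      using emb_imp_proj_subequiv(2)[OF F] unfolding KPhi_zero_def by blast
    then show False using c(1) by blast
  qed
  ultimately show ?thesis by blast
qed

end
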